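(* (Bounded Weak* Convergence Theorem) Let $E,F$ be Banach spaces and let $\mu\colon\mathfrak{M}\to\mathcal{L}(E,F^* )$ be a weak* i-measure, where $\mathfrak{M}$ is a $\sigma$-algebra on a set $Z$. If $f_n\in M_{\mathfrak{M}}(Z,E)$ are uniformly bounded and converge pointwise to $f\colon Z\to E$ in the weak topology of $E$, then $\int^{w*}_Z f_n\,\mathrm{d}\mu$ converge to $\int^{w*}_Z f\,\mathrm{d}\mu$ in the weak* topology of $F^*$.
   Context: Banach spaces are over a fixed field $\mathbb{K}$ of real or complex numbers; $\mathcal{L}(E,G)$ is the Banach space of continuous linear operators $E\to G$. For $T_n\in\mathcal{L}(E,G)$, the series $\sum_n T_n$ is independently convergent if $\sum_n T_nx_n$ converges in the norm of $G$ for every bounded sequence $(x_n)$ in $E$. A set function $\nu\colon\mathfrak{M}\to\mathcal{L}(E,G)$ is an i-measure if for any pairwise disjoint $A_n\in\mathfrak{M}$, $\nu(\bigcup_n A_n)x=\sum_n\nu(A_n)x$ for each $x\in E$ and $\sum_n\nu(A_n)$ is independently convergent. A set function $\mu\colon\mathfrak{M}\to\mathcal{L}(E,F^* )$ is a weak* i-measure if for every $v\in F$ the set function $\mathfrak{M}\ni A\mapsto\langle v,\mu(A)(\cdot)\rangle\in\mathcal{L}(E,\mathbb{K})$ is an i-measure, where $\langle v,T(\cdot)\rangle$ denotes the functional $E\ni x\mapsto(Tx)(v)\in\mathbb{K}$. Its total semivariation $\|\mu\|_Z$ is the supremum of $\|\sum_{n=1}^N\mu(A_n)x_n\|$ over finite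 $N$, pairwise disjoint $A_n\in\mathfrak{M}$, $x_n\in E$ with $\|x_n\|\le1$; it is known to be finite. $\ell_\infty(Z,E)$ is the space of bounded functions $Z\to E$ with the sup-norm. $M_{\mathfrak{M}}(Z,E)$ is the subspace of all bounded $f\colon Z\to E$ such that $f(Z)$ is separable and $\psi\circ f$ is $\mathfrak{M}$-measurable for each $\psi\in E^*$ (it is closed under pointwise weak limits of uniformly bounded sequences). $S_{\mathfrak{M}}(Z,E)$ is the set of $f\in\ell_\infty(Z,E)$ with $f(Z)$ countable and $f^{-1}(\{e\})\in\mathfrak{M}$ for all $e\in E$; for such $f$, the weak* integral $\int^{w*}_Z f\,\mathrm{d}\mu\in F^*$ is given by $(\int^{w*}_Z f\,\mathrm{d}\mu)(v)=\sum_{e\in E}(\mu(f^{-1}(\{e\}))e)(v)$ for $v\in F$. This is a continuous linear operator on $S_{\mathfrak{M}}(Z,E)$ of norm $\|\mu\|_Z$; since $S_{\mathfrak{M}}(Z,E)$ is uniformly dense in $M_{\mathfrak{M}}(Z,E)$, the weak* integral on $M_{\mathfrak{M}}(Z,E)$ is defined as its unique continuous extension. *)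

theory Defs
  imports "HOL-Analysis.Analysis"
begin

section \<open>Scalars, Banach spaces over a scalar field, bounded operators\<close>

(* The scalar field K: isometrically isomorphic, as a field, to the reals or the complex numbers. *)
class real_or_complex = real_normed_field + euclidean_space +
  assumes real_or_complex:
    "(\<exists>h::'a \<Rightarrow> real. bij h \<and> (\<forall>x y. h (x + y) = h x + h y) \<and> (\<forall>x y. h (x * y) = h x * h y)
        \<and> (\<forall>x. norm (h x) = norm x))
   \<or> (\<exists>h::'a \<Rightarrow> complex. bij h \<and> (\<forall>x y. h (x + y) = h x + h y) \<and> (\<forall>x y. h (x * y) = h x * h y)
        \<and> (\<forall>x. norm (h x) = norm x))"

instance real :: real_or_complex
  by standard (rule disjI1, rule exI[of _ "\<lambda>x. x"], simp add: bij_def)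

instance complex :: real_or_complex
  by standard (rule disjI2, rule exI[of _ "\<lambda>x. x"], simp add: bij_def)

(* The library's normed spaces are real; a K-structure is a scalar multiplication by K that extends
   the real one and is compatible with the norm.  Completeness is the sort constraint banach. *)
locale banach_space_over = vector_space scale
  for scale :: "'k::real_or_complex \<Rightarrow> 'e::banach \<Rightarrow> 'e" +
  assumes norm_scale: "norm (scale c x) = norm c * norm x"
    and scale_of_real: "scale (of_real r) x = r *\<^sub>R x"

(* L(E,G) inside the space of real-linear bounded operators.  The operator norm depends only on
   the norms of E and G, so it is the one of the ambient type. *)
definition bounded_ops ::
  "('k \<Rightarrow> 'e \<Rightarrow> 'e) \<Rightarrow> ('k \<Rightarrow> 'g \<Rightarrow> 'g) \<Rightarrow> ('e::real_normed_vector \<Rightarrow>\<^sub>L 'g::real_normed_vector) set" where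
  "bounded_ops sE sG = {T. \<forall>c x. blinfun_apply T (sE c x) = sG c (blinfun_apply T x)}"

definition dual_space :: "('k::real_or_complex \<Rightarrow> 'e \<Rightarrow> 'e) \<Rightarrow> ('e::real_normed_vector \<Rightarrow>\<^sub>L 'k) set" where
  "dual_space sE = bounded_ops sE (*)"

(* L(E,F^* ), where F^* carries the scalar multiplication (c \<phi>)(v) = c \<phi>(v). *)
definition bounded_ops_to_dual ::
  "('k::real_or_complex \<Rightarrow> 'e \<Rightarrow> 'e) \<Rightarrow> ('k \<Rightarrow> 'f \<Rightarrow> 'f)
     \<Rightarrow> ('e::real_normed_vector \<Rightarrow>\<^sub>L ('f::real_normed_vector \<Rightarrow>\<^sub>L 'k)) set" where
  "bounded_ops_to_dual sE sF =
     {T. range (blinfun_apply T) \<subseteq> dual_space sF} \<inter>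
     bounded_ops sE (\<lambda>c \<phi>. blinfun_mult_right c o\<^sub>L \<phi>)"

(* <v, T(.)>, i.e. the functional x \<mapsto> (T x)(v) *)
definition pairing ::
  "'f \<Rightarrow> ('e::real_normed_vector \<Rightarrow>\<^sub>L ('f::real_normed_vector \<Rightarrow>\<^sub>L 'k::real_normed_vector)) \<Rightarrow> ('e \<Rightarrow>\<^sub>L 'k)" where
  "pairing v T = blinfun.prod_left v o\<^sub>L T"

lemma pairing_apply [simp]: "blinfun_apply (pairing v T) x = blinfun_apply (blinfun_apply T x) v"
  by (simp add: pairing_def)

section \<open>Weak and weak* topologies\<close>

definition weak_topology :: "('k::real_or_complex \<Rightarrow> 'e \<Rightarrow> 'e) \<Rightarrow> 'e::real_normed_vector topology" where
  "weak_topology sE =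
     topology_generated_by {blinfun_apply \<psi> -` U | \<psi> U. \<psi> \<in> dual_space sE \<and> open U}"

definition weak_star_topology ::
  "('k::real_or_complex \<Rightarrow> 'f \<Rightarrow> 'f) \<Rightarrow> ('f::real_normed_vector \<Rightarrow>\<^sub>L 'k) topology" where
  "weak_star_topology sF =
     topology_generated_by {{\<phi> \<in> dual_space sF. blinfun_apply \<phi> v \<in> U} | v U. open U}"

lemma limitin_topology_generated_by:
  "limitin (topology_generated_by S) f l F \<longleftrightarrow>
     l \<in> \<Union>S \<and> (\<forall>U\<in>S. l \<in> U \<longrightarrow> (\<forall>\<^sub>F n in F. f n \<in> U))" (is "?L \<longleftrightarrow> ?R")
proof
  assume ?L then show ?R
    by (auto simp: limitin_def topology_generated_by_Basis)
next
  assume R: ?R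
  have "l \<in> U \<longrightarrow> (\<forall>\<^sub>F n in F. f n \<in> U)" if "generate_topology_on S U" for U
    using that
  proof induction
    case (Int a b) then show ?case by (auto intro: eventually_conj)
  next
    case (UN K)
    show ?case
    proof
      assume "l \<in> \<Union>K"
      then obtain k where k: "k \<in> K" "l \<in> k" by blast
      with UN have "\<forall>\<^sub>F n in F. f n \<in> k" by blast
      then show "\<forall>\<^sub>F n in F. f n \<in> \<Union>K" by (rule eventually_mono) (use k in blast)
    qed
  qed (use R in auto)
  with R show ?L by (auto simp: limitin_def openin_topology_generated_by_iff)
qed

lemma ball_Collect_ex2: "(\<forall>W\<in>{g v U | v U. P v U}. Q W) \<longleftrightarrow> (\<forall>v U. P v U \<longrightarrow> Q (g v U))"
  by blast

lemma limitin_weak_topology: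
  "limitin (weak_topology sE) x l F \<longleftrightarrow>
     (\<forall>\<psi>\<in>dual_space sE. ((\<lambda>n. blinfun_apply \<psi> (x n)) \<longlongrightarrow> blinfun_apply \<psi> l) F)"
proof -
  have 0: "0 \<in> dual_space sE" by (simp add: dual_space_def bounded_ops_def)
  have "l \<in> \<Union>{blinfun_apply \<psi> -` U | \<psi> U. \<psi> \<in> dual_space sE \<and> open U}"
    by (rule UnionI[of "blinfun_apply 0 -` UNIV"], use 0 open_UNIV in blast, simp)
  then have "limitin (weak_topology sE) x l F \<longleftrightarrow>
      (\<forall>W\<in>{blinfun_apply \<psi> -` U | \<psi> U. \<psi> \<in> dual_space sE \<and> open U}.
         l \<in> W \<longrightarrow> (\<forall>\<^sub>F n in F. x n \<in> W))"
    by (simp only: weak_topology_def limitin_topology_generated_by simp_thms)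
  also have "\<dots> \<longleftrightarrow> (\<forall>\<psi>\<in>dual_space sE. \<forall>U. open U \<longrightarrow> l \<in> blinfun_apply \<psi> -` U \<longrightarrow>
      (\<forall>\<^sub>F n in F. x n \<in> blinfun_apply \<psi> -` U))"
    unfolding ball_Collect_ex2 by auto
  finally show ?thesis by (simp add: tendsto_def)
qed

lemma limitin_weak_star_topology:
  assumes "\<And>n. x n \<in> dual_space sF"
  shows "limitin (weak_star_topology sF) x l F \<longleftrightarrow> l \<in> dual_space sF \<and>
     (\<forall>v. ((\<lambda>n. blinfun_apply (x n) v) \<longlongrightarrow> blinfun_apply l v) F)"
proof -
  let ?S = "{{\<phi> \<in> dual_space sF. blinfun_apply \<phi> v \<in> U} | v U. open U}"
  have "l \<in> \<Union>?S" if "l \<in> dual_space sF"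
    by (rule UnionI[of "{\<phi> \<in> dual_space sF. blinfun_apply \<phi> 0 \<in> UNIV}"],
        use open_UNIV in blast, use that in simp)
  then have "l \<in> \<Union>?S \<longleftrightarrow> l \<in> dual_space sF" by blast
  then have "limitin (weak_star_topology sF) x l F \<longleftrightarrow>
      l \<in> dual_space sF \<and> (\<forall>W\<in>?S. l \<in> W \<longrightarrow> (\<forall>\<^sub>F n in F. x n \<in> W))"
    by (simp only: weak_star_topology_def limitin_topology_generated_by)
  also have "\<dots> \<longleftrightarrow> l \<in> dual_space sF \<and> (\<forall>v U. open U \<longrightarrow>
      l \<in> {\<phi> \<in> dual_space sF. blinfun_apply \<phi> v \<in> U} \<longrightarrow>
      (\<forall>\<^sub>F n in F. x n \<in> {\<phi> \<in> dual_space sF. blinfun_apply \<phi> v \<in> U}))"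
    unfolding ball_Collect_ex2 by (rule refl)
  finally show ?thesis using assms by (auto simp: tendsto_def)
qed

section \<open>i-measures and weak* i-measures\<close>

definition independently_convergent ::
  "(nat \<Rightarrow> ('e::real_normed_vector \<Rightarrow>\<^sub>L 'g::real_normed_vector)) \<Rightarrow> bool" where
  "independently_convergent T \<longleftrightarrow>
     (\<forall>x. bounded (range x) \<longrightarrow> summable (\<lambda>n. blinfun_apply (T n) (x n)))"

definition i_measure ::
  "('k \<Rightarrow> 'e \<Rightarrow> 'e) \<Rightarrow> ('k \<Rightarrow> 'g \<Rightarrow> 'g) \<Rightarrow> 'z set set
     \<Rightarrow> ('z set \<Rightarrow> ('e::real_normed_vector \<Rightarrow>\<^sub>L 'g::real_normed_vector)) \<Rightarrow> bool" where
  "i_measure sE sG \<MM> \<nu> \<longleftrightarrow>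
     \<nu> ` \<MM> \<subseteq> bounded_ops sE sG \<and>
     (\<forall>A::nat \<Rightarrow> 'z set. range A \<subseteq> \<MM> \<longrightarrow> disjoint_family A \<longrightarrow>
        (\<forall>x. (\<lambda>n. blinfun_apply (\<nu> (A n)) x) sums blinfun_apply (\<nu> (\<Union>n. A n)) x) \<and>
        independently_convergent (\<lambda>n. \<nu> (A n)))"

definition weak_star_i_measure ::
  "('k::real_or_complex \<Rightarrow> 'e \<Rightarrow> 'e) \<Rightarrow> ('k \<Rightarrow> 'f \<Rightarrow> 'f) \<Rightarrow> 'z set set
     \<Rightarrow> ('z set \<Rightarrow> ('e::real_normed_vector \<Rightarrow>\<^sub>L ('f::real_normed_vector \<Rightarrow>\<^sub>L 'k))) \<Rightarrow> bool" where
  "weak_star_i_measure sE sF \<MM> \<mu> \<longleftrightarrow>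
     \<mu> ` \<MM> \<subseteq> bounded_ops_to_dual sE sF \<and>
     (\<forall>v. i_measure sE (*) \<MM> (\<lambda>A. pairing v (\<mu> A)))"

section \<open>Function spaces and the weak* integral\<close>

(* Functions on Z are total functions whose values outside Z are irrelevant. *)

definition M_functions ::
  "('k::real_or_complex \<Rightarrow> 'e \<Rightarrow> 'e) \<Rightarrow> 'z set \<Rightarrow> 'z set set \<Rightarrow> ('z \<Rightarrow> 'e::real_normed_vector) set" where
  "M_functions sE Z \<MM> = {f. bounded (f ` Z) \<and> separable_space (top_of_set (f ` Z)) \<and>
     (\<forall>\<psi>\<in>dual_space sE. blinfun_apply \<psi> \<circ> f \<in> borel_measurable (sigma Z \<MM>))}"

definition S_functions :: "'z set \<Rightarrow> 'z set set \<Rightarrow> ('z \<Rightarrow> 'e::real_normed_vector) set" where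
  "S_functions Z \<MM> = {f. bounded (f ` Z) \<and> countable (f ` Z) \<and> (\<forall>e. f -` {e} \<inter> Z \<in> \<MM>)}"

definition weak_star_integral_S ::
  "'z set \<Rightarrow> ('z set \<Rightarrow> ('e::real_normed_vector \<Rightarrow>\<^sub>L ('f::real_normed_vector \<Rightarrow>\<^sub>L 'k::real_normed_vector)))
     \<Rightarrow> ('z \<Rightarrow> 'e) \<Rightarrow> ('f \<Rightarrow>\<^sub>L 'k)" where
  "weak_star_integral_S Z \<mu> f =
     Blinfun (\<lambda>v. \<Sum>\<^sub>\<infinity>e\<in>UNIV. blinfun_apply (blinfun_apply (\<mu> (f -` {e} \<inter> Z)) e) v)"

(* The unique F^*-valued extension of the integral from S to M that is continuous for the sup-norm.
   Continuity is spelled out with sup_{z \<in> Z} norm (f z - g z) \<le> \<delta> written pointwise, which also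
   covers empty Z; outside M the integral takes the dummy value undefined. *)
definition weak_star_integral ::
  "('k::real_or_complex \<Rightarrow> 'e \<Rightarrow> 'e) \<Rightarrow> ('k \<Rightarrow> 'f \<Rightarrow> 'f) \<Rightarrow> 'z set \<Rightarrow> 'z set set
     \<Rightarrow> ('z set \<Rightarrow> ('e::real_normed_vector \<Rightarrow>\<^sub>L ('f::real_normed_vector \<Rightarrow>\<^sub>L 'k)))
     \<Rightarrow> ('z \<Rightarrow> 'e) \<Rightarrow> ('f \<Rightarrow>\<^sub>L 'k)" where
  "weak_star_integral sE sF Z \<MM> \<mu> = (THE I.
     I \<in> M_functions sE Z \<MM> \<rightarrow>\<^sub>E dual_space sF \<and>
     (\<forall>s\<in>S_functions Z \<MM>. I s = weak_star_integral_S Z \<mu> s) \<and>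
     (\<forall>f\<in>M_functions sE Z \<MM>. \<forall>\<epsilon>>0. \<exists>\<delta>>0. \<forall>g\<in>M_functions sE Z \<MM>.
        (\<forall>z\<in>Z. norm (f z - g z) \<le> \<delta>) \<longrightarrow> norm (I f - I g) < \<epsilon>))"

end

theory Submission
  imports Defs
begin

text \<open>
For fixed \<open>v \<in> F\<close> and a real coordinate of the scalar field, \<open>\<mu>\<close> becomes a measure \<open>\<nu>\<close> with
values in the real dual of \<open>E\<close>.  Independent convergence forces \<open>\<Sum>\<parallel>\<nu> (A\<^sub>n)\<parallel> < \<infinity>\<close> for disjoint \<open>A\<^sub>n\<close>,
so the variation \<open>|\<nu>|\<close> is a finite measure.  \<open>E\<^sup>*\<close> need not have the Radon-Nikodym property,
but only a separable subspace \<open>E\<^sub>0\<close> of \<open>E\<close> matters: on a countable dense set \<open>Q \<subseteq> E\<^sub>0\<close> the scalar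
Radon-Nikodym densities of \<open>\<nu>(\<cdot>) q\<close> are almost everywhere additive in \<open>q\<close> and bounded by the norm,
hence extend by Hahn-Banach to functionals \<open>\<phi> z\<close> on \<open>E\<close> with \<open>\<integral> f d\<nu> = \<integral> \<phi> z (f z) d|\<nu>|(z)\<close>
whenever \<open>f\<close> takes its values in \<open>E\<^sub>0\<close>.  Now \<open>f\<^sub>n z \<rightarrow> f z\<close> weakly gives \<open>\<phi> z (f\<^sub>n z) \<rightarrow> \<phi> z (f z)\<close>,
and dominated convergence applies.
\<close>

section \<open>Hahn-Banach extension and uniform boundedness\<close>

text \<open>The variation is finite only after \<open>v\<close> is fixed: as a measure with operator
  values, \<open>\<mu>\<close> itself may have infinite variation. So the bounds obtained from
  densities depend on \<open>v\<close>, whereas extending the integral from countably valued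
  functions needs a bound linear in \<open>norm v\<close>. Uniform boundedness supplies it, and with
  it the existence and uniqueness behind the definite description in
  \<open>weak_star_integral\<close>. Each property of the densities holds only off a null set, and
  only countably many null sets may be discarded; this is why \<open>Q\<close> is countable and
  everything is tested on it. Extending \<open>\<phi> z\<close> to all of \<open>E\<close> makes it
  a functional to which weak convergence applies. One \<open>Q\<close> has to serve all
  \<open>f\<^sub>n\<close> and their limit; that the limit cannot leave \<open>closure Q\<close> is
  Hahn-Banach separation. Passing to real functionals loses nothing, since each is a real-linear
  function of a scalar-linear one.\<close>

lemma additive_bounded_imp_bounded_linear:
  fixes f :: "'a::real_normed_vector \<Rightarrow> 'b::real_normed_vector"
  assumes add: "\<And>x y. f (x + y) = f x + f y" and bound: "\<And>x. norm (f x) \<le> K * norm x"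
  shows "bounded_linear f"
proof (rule bounded_linear_intro[OF add _ bound[unfolded mult.commute[of K]]])
  interpret additive f by standard (rule add)
  fix r :: real and x :: 'a
  have scale_nat: "f (real n *\<^sub>R y) = real n *\<^sub>R f y" for n y
    by (induction n) (simp_all add: zero add scaleR_add_left)
  have scale_int: "f (of_int i *\<^sub>R y) = of_int i *\<^sub>R f y" for i y
  proof (cases i rule: int_cases2)
    case (nonneg n) then show ?thesis by (simp add: scale_nat)
  next
    case (nonpos n) then show ?thesis by (simp add: scale_nat minus)
  qed
  have scale_rat: "f (q *\<^sub>R y) = q *\<^sub>R f y" if q: "q \<in> \<rat>" for q y
  proof -
    obtain a b where ab: "b > 0" "q = of_int a / of_int b"
      using q by (meson Rats_cases')
    have "of_int b *\<^sub>R f (q *\<^sub>R y) = f (of_int b *\<^sub>R q *\<^sub>R y)" by (simp only: scale_int)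
    also have "\<dots> = f (of_int a *\<^sub>R y)" using ab by simp
    also have "\<dots> = of_int b *\<^sub>R q *\<^sub>R f y" using ab by (simp add: scale_int)
    finally show ?thesis unfolding scaleR_cancel_left using ab(1) by simp
  qed
  have "continuous_on UNIV f"
    unfolding continuous_on_iff
  proof (intro ballI allI impI)
    fix x :: 'a and e :: real assume e: "e > 0"
    \<comment> \<open>\<open>K\<close> may be zero or negative, hence
      \<open>\<bar>K\<bar> + 1\<close>.\<close>
    have "dist (f y) (f x) < e" if "dist y x < e / (\<bar>K\<bar> + 1)" for y
    proof -
      have "dist (f y) (f x) \<le> K * dist y x"
        using bound[of "y - x"] by (simp add: dist_norm diff)
      also have "\<dots> \<le> (\<bar>K\<bar> + 1) * dist y x" by (intro mult_right_mono) auto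
      also have "\<dots> < e" using that by (simp add: field_simps)
      finally show ?thesis .
    qed
    then show "\<exists>d>0. \<forall>x'\<in>UNIV. dist x' x < d \<longrightarrow> dist (f x') (f x) < e"
      using e by (intro exI[of _ "e / (\<bar>K\<bar> + 1)"]) auto
  qed
  then have cont: "continuous_on UNIV (\<lambda>r. f (r *\<^sub>R x))"
    by (rule continuous_on_compose2) (auto intro!: continuous_intros)
  have "closed {r. f (r *\<^sub>R x) = r *\<^sub>R f x}"
    by (intro closed_Collect_eq cont continuous_intros)
  then have "closure \<rat> \<subseteq> {r. f (r *\<^sub>R x) = r *\<^sub>R f x}"
    by (intro closure_minimal) (auto simp: scale_rat)
  then show "f (r *\<^sub>R x) = r *\<^sub>R f x" using Rats_closure_real by auto
qed

text \<open>Homogeneity only over the naturals allows infima over rational subspaces; a minimal such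
functional is additive and bounded, hence real-linear anyway.\<close>

definition subnorm :: "('a::real_normed_vector \<Rightarrow> real) \<Rightarrow> bool" where
  "subnorm p \<longleftrightarrow> (\<forall>x y. p (x + y) \<le> p x + p y) \<and> (\<forall>n x. p (real n *\<^sub>R x) = real n * p x) \<and>
     (\<forall>x. p x \<le> norm x)"

text \<open>Subadditivity already gives \<open>p (n x) \<le> n * p x\<close> by induction, so the
  converse for positive \<open>n\<close> is what remains to be checked. The value at
  \<open>0\<close> is forced: subadditivity makes it nonnegative, the norm bound
  nonpositive.\<close>

lemma subnormI:
  assumes "\<And>x y. p (x + y) \<le> p x + p y" and "\<And>n x. n > 0 \<Longrightarrow> real n * p x \<le> p (real n *\<^sub>R x)"
    and "\<And>x. p x \<le> norm x"
  shows "subnorm p"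
  unfolding subnorm_def
proof (intro conjI allI assms)
  fix n x
  have p0: "p 0 = 0" using assms(1)[of 0 0] assms(3)[of 0] by simp
  have "p (real n *\<^sub>R x) \<le> real n * p x"
  proof (induction n)
    case (Suc n)
    have "p (real (Suc n) *\<^sub>R x) \<le> p x + p (real n *\<^sub>R x)"
      using assms(1)[of x "real n *\<^sub>R x"] by (simp add: scaleR_add_left)
    with Suc show ?case by (simp add: algebra_simps)
  qed (simp add: p0)
  moreover have "real n * p x \<le> p (real n *\<^sub>R x)" using assms(2)[of n x] p0 by (cases n) auto
  ultimately show "p (real n *\<^sub>R x) = real n * p x" by simp
qed

lemma subnormD:
  assumes "subnorm p"
  shows "p (x + y) \<le> p x + p y" "p (real n *\<^sub>R x) = real n * p x" "p x \<le> norm x" "p 0 = 0"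
    "- p x \<le> p (- x)" "- norm x \<le> p x"
proof -
  show *: "p (x + y) \<le> p x + p y" "p (real n *\<^sub>R x) = real n * p x" "p x \<le> norm x" for x y n
    using assms by (auto simp: subnorm_def)
  show 0: "p 0 = 0" using *(2)[of 0 0] by simp
  show **: "- p x \<le> p (- x)" for x using *(1)[of x "- x"] 0 by simp
  show "- norm x \<le> p x" using **[of "- x"] *(3)[of "- x"] by simp
qed

lemma subnorm_norm: "subnorm norm"
  by (rule subnormI) (auto intro: norm_triangle_ineq)

text \<open>A subnorm \<open>q \<le> p\<close> with \<open>q (- y) \<le> - p y\<close> satisfies
  \<open>q \<le> p'\<close>, so \<open>p'\<close> is the largest such \<open>q\<close>: the least
  change of \<open>p\<close> that makes it odd at \<open>y\<close>. It drives both the minimality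
  argument and the construction of supporting functionals.\<close>

lemma subnorm_drop:
  fixes y :: "'a::real_normed_vector"
  assumes p: "subnorm p"
  defines "p' \<equiv> \<lambda>x. INF n. p (x + real n *\<^sub>R y) - real n * p y"
  shows "subnorm p'" "p' x \<le> p x" "p' (- y) \<le> - p y"
proof -
  note pD = subnormD[OF p]
  have lower: "- p (- x) \<le> p (x + real n *\<^sub>R y) - real n * p y" for x n
    using pD(1)[of "x + real n *\<^sub>R y" "- x"] pD(2)[of n y] by simp
  then have bdd: "bdd_below (range (\<lambda>n. p (x + real n *\<^sub>R y) - real n * p y))" for x by fast
  then have le: "p' x \<le> p (x + real n *\<^sub>R y) - real n * p y" for x n
    unfolding p'_def by (rule cINF_lower) simp
  have ge: "c \<le> p' x" if "\<And>n. c \<le> p (x + real n *\<^sub>R y) - real n * p y" for c x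
    unfolding p'_def by (rule cINF_greatest) (use that in auto)
  show le_p: "p' x \<le> p x" for x using le[of x 0] by simp
  show "p' (- y) \<le> - p y" using le[of "- y" 1] pD(4) by simp
  show "subnorm p'"
  proof (rule subnormI)
    fix u w
    have "p' (u + w) - (p (u + real n *\<^sub>R y) - real n * p y) \<le> p (w + real m *\<^sub>R y) - real m * p y" for n m
      using le[of "u + w" "n + m"] pD(1)[of "u + real n *\<^sub>R y" "w + real m *\<^sub>R y"]
      by (simp add: algebra_simps)
    then have "p' (u + w) - (p (u + real n *\<^sub>R y) - real n * p y) \<le> p' w" for n by (rule ge)
    then have "p' (u + w) - p' w \<le> p' u" by (intro ge) (simp add: algebra_simps)
    then show "p' (u + w) \<le> p' u + p' w" by simp
  next
    fix k :: nat and u assume k: "k > 0"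
    show "real k * p' u \<le> p' (real k *\<^sub>R u)"
    proof (rule ge)
      fix n
      \<comment> \<open>The natural index for \<open>u\<close> would be \<open>n / k\<close>. With
        index \<open>n\<close> instead, multiplying by \<open>k\<close> produces
        \<open>k * n\<close> copies of \<open>y\<close>; the surplus \<open>m\<close> copies are
        split off by subadditivity at the cost \<open>m * p y\<close>, which the subtracted term
        returns exactly.\<close>
      have "n \<le> k * n" using k by (cases k) auto
      then obtain m where m: "k * n = n + m" using le_Suc_ex by blast
      have *: "real k * real n = real n + real m" by (metis m of_nat_add of_nat_mult)
      have "real k * p' u \<le> real k * (p (u + real n *\<^sub>R y) - real n * p y)"
        by (intro mult_left_mono le) simp
      also have "\<dots> = p (real k *\<^sub>R (u + real n *\<^sub>R y)) - (real k * real n) * p y"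
        unfolding pD(2) by (simp add: right_diff_distrib)
      also have "real k *\<^sub>R (u + real n *\<^sub>R y) = (real k *\<^sub>R u + real n *\<^sub>R y) + real m *\<^sub>R y"
        by (simp add: scaleR_add_right * scaleR_add_left)
      also have "p \<dots> \<le> p (real k *\<^sub>R u + real n *\<^sub>R y) + real m * p y"
        using pD(1)[of "real k *\<^sub>R u + real n *\<^sub>R y" "real m *\<^sub>R y"] unfolding pD(2) .
      finally show "real k * p' u \<le> p (real k *\<^sub>R u + real n *\<^sub>R y) - real n * p y"
        unfolding * by (simp add: algebra_simps)
    qed
  next
    show "p' u \<le> norm u" for u using le_p[of u] pD(3)[of u] by simp
  qed
qed

text \<open>Lower bounds of chains for Zorn's lemma. The infimum is finite because every member
  dominates \<open>- norm x\<close>; the chain property enters in subadditivity, where a single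
  member must be small at \<open>x\<close> and at \<open>y\<close>.\<close>

lemma subnorm_chain_INF:
  assumes ne: "C \<noteq> {}" and C: "\<And>p. p \<in> C \<Longrightarrow> subnorm p"
    and chain: "\<And>p q. p \<in> C \<Longrightarrow> q \<in> C \<Longrightarrow> p \<le> q \<or> q \<le> p"
  shows "subnorm (\<lambda>x. INF p\<in>C. p x)" "\<And>p. p \<in> C \<Longrightarrow> (\<lambda>x. INF p\<in>C. p x) \<le> p"
proof -
  have "bdd_below ((\<lambda>p. p x) ` C)" for x
    using subnormD(6)[OF C, of _ x] by (intro bdd_belowI2)
  then have le: "p \<in> C \<Longrightarrow> (INF p\<in>C. p x) \<le> p x" for p x by (rule cINF_lower)
  then show "p \<in> C \<Longrightarrow> (\<lambda>x. INF p\<in>C. p x) \<le> p" for p by (auto simp: le_fun_def)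
  have ge: "c \<le> (INF p\<in>C. p x)" if "\<And>p. p \<in> C \<Longrightarrow> c \<le> p x" for c x
    by (rule cINF_greatest[OF ne that])
  show "subnorm (\<lambda>x. INF p\<in>C. p x)"
  proof (rule subnormI)
    fix x y
    have "(INF p\<in>C. p (x + y)) - p x \<le> q y" if pq: "p \<in> C" "q \<in> C" for p q
    proof -
      obtain r where r: "r \<in> C" "r x \<le> p x" "r y \<le> q y"
        using chain[OF pq] pq by (auto simp: le_fun_def)
      show ?thesis using le[OF r(1), of "x + y"] subnormD(1)[OF C[OF r(1)], of x y] r by simp
    qed
    then have "(INF p\<in>C. p (x + y)) - p x \<le> (INF p\<in>C. p y)" if "p \<in> C" for p
      using that by (intro ge)
    then have "(INF p\<in>C. p (x + y)) - (INF p\<in>C. p y) \<le> (INF p\<in>C. p x)"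
      by (intro ge) (simp add: algebra_simps)
    then show "(INF p\<in>C. p (x + y)) \<le> (INF p\<in>C. p x) + (INF p\<in>C. p y)" by simp
  next
    fix n :: nat and x
    show "real n * (INF p\<in>C. p x) \<le> (INF p\<in>C. p (real n *\<^sub>R x))"
      by (rule ge) (simp add: subnormD(2)[OF C] mult_left_mono le)
  next
    fix x
    from ne obtain p where "p \<in> C" by blast
    then show "(INF p\<in>C. p x) \<le> norm x" using le[of p x] subnormD(3)[OF C, of p x] by simp
  qed
qed

text \<open>A minimal \<open>m\<close> below \<open>p\<close> is unchanged by
  \<open>subnorm_drop\<close> in every direction, so \<open>m (- y) \<le> - m y\<close>. With
  subadditivity this yields additivity, and an additive function bounded by the norm is
  linear.\<close>

theorem hahn_banach_subnorm:
  fixes p :: "'a::real_normed_vector \<Rightarrow> real"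
  assumes p: "subnorm p"
  shows "\<exists>\<phi> :: 'a \<Rightarrow>\<^sub>L real. \<forall>x. blinfun_apply \<phi> x \<le> p x"
proof -
  let ?A = "{q. subnorm q \<and> q \<le> p}"
  have "\<exists>m\<in>?A. \<forall>a\<in>?A. a \<le> m \<longrightarrow> a = m"
  proof (rule predicate_Zorn)
    show "partial_order_on ?A (relation_of (\<lambda>a b. b \<le> a) ?A)"
      by (rule partial_order_on_relation_ofI) auto
  next
    fix C assume "C \<in> Chains (relation_of (\<lambda>a b. b \<le> a) ?A)"
    then have C: "C \<subseteq> ?A" "\<And>q r. q \<in> C \<Longrightarrow> r \<in> C \<Longrightarrow> q \<le> r \<or> r \<le> q"
      by (auto simp: Chains_def relation_of_def)
    show "\<exists>u\<in>?A. \<forall>a\<in>C. u \<le> a"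
    proof (cases "C = {}")
      case True then show ?thesis using p by auto
    next
      case False
      have sub: "subnorm q" if "q \<in> C" for q using that C(1) by blast
      have INF: "subnorm (\<lambda>x. INF p\<in>C. p x)" "\<And>q. q \<in> C \<Longrightarrow> (\<lambda>x. INF p\<in>C. p x) \<le> q"
        by (rule subnorm_chain_INF[OF False]; use sub C(2) in blast)+
      obtain q where q: "q \<in> C" using False by blast
      then have "q \<le> p" using C(1) by blast
      with INF(2)[OF q] have "(\<lambda>x. INF p\<in>C. p x) \<le> p" by (rule order_trans)
      with INF show ?thesis by (intro bexI[of _ "\<lambda>x. INF p\<in>C. p x"]) auto
    qed
  qed
  then obtain m where m: "subnorm m" "m \<le> p"
    and min: "\<And>a. subnorm a \<Longrightarrow> a \<le> p \<Longrightarrow> a \<le> m \<Longrightarrow> a = m" by blast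
  note mD = subnormD[OF m(1)]
  have neg: "m (- y) \<le> - m y" for y
  proof -
    let ?m = "\<lambda>x. INF n. m (x + real n *\<^sub>R y) - real n * m y"
    have le: "?m \<le> m" using subnorm_drop(2)[OF m(1)] by (auto simp: le_fun_def)
    have eq: "?m = m"
      by (rule min[OF subnorm_drop(1)[OF m(1)] order_trans[OF le m(2)] le])
    show ?thesis using subnorm_drop(3)[OF m(1), of y] fun_cong[OF eq, of "- y"] by linarith
  qed
  have add: "m (x + y) = m x + m y" for x y
    using mD(1)[of x y] mD(1)[of "x + y" "- y"] neg[of y] by simp
  have "norm (m x) \<le> 1 * norm x" for x using mD(3,6)[of x] by simp
  then have "bounded_linear m" by (rule additive_bounded_imp_bounded_linear[OF add])
  then show ?thesis
    using m(2) by (intro exI[of _ "Blinfun m"]) (simp add: bounded_linear_Blinfun_apply le_fun_def)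
qed

text \<open>A functional below the dropped subnorm obeys \<open>\<phi> (- y) \<le> - p y\<close>,
  which is the missing inequality \<open>p y \<le> \<phi> y\<close>.\<close>

lemma hahn_banach_support:
  fixes p :: "'a::real_normed_vector \<Rightarrow> real"
  assumes p: "subnorm p"
  shows "\<exists>\<phi> :: 'a \<Rightarrow>\<^sub>L real. (\<forall>x. blinfun_apply \<phi> x \<le> p x) \<and> blinfun_apply \<phi> y = p y"
proof -
  obtain \<phi> :: "'a \<Rightarrow>\<^sub>L real"
    where \<phi>: "\<And>x. blinfun_apply \<phi> x \<le> (INF n. p (x + real n *\<^sub>R y) - real n * p y)"
    using hahn_banach_subnorm[OF subnorm_drop(1)[OF p, of y]] by blast
  have le: "blinfun_apply \<phi> x \<le> p x" for x using \<phi>[of x] subnorm_drop(2)[OF p, of x y] by simp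
  moreover have "blinfun_apply \<phi> y = p y"
    using le[of y] order_trans[OF \<phi>[of "- y"] subnorm_drop(3)[OF p, of y]]
    by (simp add: blinfun.minus_right)
  ultimately show ?thesis by blast
qed

lemma norm_blinfun_le_1:
  fixes \<phi> :: "'a::real_normed_vector \<Rightarrow>\<^sub>L real"
  assumes "\<And>x. blinfun_apply \<phi> x \<le> norm x"
  shows "norm \<phi> \<le> 1"
proof (rule norm_blinfun_bound)
  show "norm (blinfun_apply \<phi> x) \<le> 1 * norm x" for x
    using assms[of x] assms[of "- x"] by (simp add: blinfun.minus_right)
qed simp

lemma abs_blinfun_le_norm:
  fixes \<phi> :: "'a::real_normed_vector \<Rightarrow>\<^sub>L real"
  assumes "norm \<phi> \<le> 1"
  shows "\<bar>blinfun_apply \<phi> x\<bar> \<le> norm x"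
  using norm_blinfun[of \<phi> x] mult_right_mono[OF assms, of "norm x"] by simp

lemma norming_functional:
  fixes y :: "'a::real_normed_vector"
  obtains \<phi> :: "'a \<Rightarrow>\<^sub>L real" where "norm \<phi> \<le> 1" "blinfun_apply \<phi> y = norm y"
proof -
  obtain \<phi> :: "'a \<Rightarrow>\<^sub>L real" where "\<And>x. blinfun_apply \<phi> x \<le> norm x" "blinfun_apply \<phi> y = norm y"
    using hahn_banach_support[OF subnorm_norm, of y] by blast
  then show thesis by (intro that[of \<phi>] norm_blinfun_le_1)
qed

section \<open>Extension from rational subspaces and their weak closedness\<close>

definition rational_subspace :: "'a::real_vector set \<Rightarrow> bool" where
  "rational_subspace Q \<longleftrightarrow> 0 \<in> Q \<and> (\<forall>x\<in>Q. \<forall>y\<in>Q. x + y \<in> Q) \<and> (\<forall>r\<in>\<rat>. \<forall>x\<in>Q. r *\<^sub>R x \<in> Q)"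

lemma countable_rational_span:
  fixes D :: "'a::real_vector set"
  assumes "countable D"
  obtains Q where "countable Q" "D \<subseteq> Q" "rational_subspace Q"
proof
  let ?g = "\<lambda>(r, x). r *\<^sub>R x"
  let ?Q = "(\<lambda>l. sum_list (map ?g l)) ` lists (\<rat> \<times> D)"
  show "countable ?Q"
    using assms by (intro countable_image countable_lists countable_SIGMA countable_rat)
  show "D \<subseteq> ?Q"
  proof
    fix x assume "x \<in> D"
    then show "x \<in> ?Q" by (intro image_eqI[of _ _ "[(1, x)]"]) auto
  qed
  show "rational_subspace ?Q"
    unfolding rational_subspace_def
  proof (intro conjI ballI)
    show "0 \<in> ?Q" by (intro image_eqI[of _ _ "[]"]) auto
    fix x y assume "x \<in> ?Q" "y \<in> ?Q"
    then obtain k l where "k \<in> lists (\<rat> \<times> D)" "l \<in> lists (\<rat> \<times> D)"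
      "x = sum_list (map ?g k)" "y = sum_list (map ?g l)" by blast
    then show "x + y \<in> ?Q" by (intro image_eqI[of _ _ "k @ l"]) auto
  next
    fix r :: real and x assume r: "r \<in> \<rat>" and "x \<in> ?Q"
    then obtain l where l: "l \<in> lists (\<rat> \<times> D)" "x = sum_list (map ?g l)" by blast
    have "r *\<^sub>R sum_list (map ?g l) = sum_list (map ?g (map (\<lambda>(s, x). (r * s, x)) l))"
      by (induction l) (auto simp: scaleR_add_right)
    moreover have "map (\<lambda>(s, x). (r * s, x)) l \<in> lists (\<rat> \<times> D)" using l(1) r by (fastforce intro: Rats_mult)
    ultimately show "r *\<^sub>R x \<in> ?Q" unfolding l(2) by blast
  qed
qed

text \<open>\<open>p\<close> is the infimal convolution of the norm with \<open>g\<close>. The lower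
  bound on \<open>g\<close> keeps the infimum finite, the choice \<open>q = 0\<close> gives
  \<open>p \<le> norm\<close>, and \<open>x = q\<close> gives \<open>p \<le> g\<close> on
  \<open>Q\<close>. For \<open>g = 0\<close> it is the distance to \<open>Q\<close>.\<close>

lemma subnorm_extension:
  fixes g :: "'a::real_normed_vector \<Rightarrow> real"
  assumes Q: "rational_subspace Q"
    and g: "\<And>x y. x \<in> Q \<Longrightarrow> y \<in> Q \<Longrightarrow> g (x + y) = g x + g y" "\<And>x. x \<in> Q \<Longrightarrow> - norm x \<le> g x"
  defines "p \<equiv> \<lambda>x. INF q\<in>Q. norm (x - q) + g q"
  shows "subnorm p" "q \<in> Q \<Longrightarrow> p x \<le> norm (x - q) + g q"
proof -
  have Q0: "0 \<in> Q" and Qa: "\<And>x y. x \<in> Q \<Longrightarrow> y \<in> Q \<Longrightarrow> x + y \<in> Q"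
    and Qs: "\<And>r x. r \<in> \<rat> \<Longrightarrow> x \<in> Q \<Longrightarrow> r *\<^sub>R x \<in> Q"
    using Q by (auto simp: rational_subspace_def)
  have "- norm x \<le> norm (x - q) + g q" if "q \<in> Q" for x q
    using g(2)[OF that] norm_triangle_ineq2[of q x] by (simp add: norm_minus_commute)
  then have "bdd_below ((\<lambda>q. norm (x - q) + g q) ` Q)" for x by (intro bdd_belowI2)
  then show le: "q \<in> Q \<Longrightarrow> p x \<le> norm (x - q) + g q" for x q
    unfolding p_def by (rule cINF_lower)
  have ge: "c \<le> p x" if "\<And>q. q \<in> Q \<Longrightarrow> c \<le> norm (x - q) + g q" for c x
    unfolding p_def by (rule cINF_greatest) (use Q0 that in auto)
  have g0: "g 0 = 0" using g(1)[of 0 0] Q0 by simp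
  show "subnorm p"
  proof (rule subnormI)
    fix x y
    have "p (x + y) - (norm (x - q) + g q) \<le> norm (y - r) + g r" if "q \<in> Q" "r \<in> Q" for q r
      using le[OF Qa[OF that], of "x + y"] g(1)[OF that] norm_triangle_ineq[of "x - q" "y - r"]
      by (simp add: algebra_simps)
    then have "p (x + y) - (norm (x - q) + g q) \<le> p y" if "q \<in> Q" for q
      using that by (intro ge)
    then have "p (x + y) - p y \<le> p x" by (intro ge) (simp add: algebra_simps)
    then show "p (x + y) \<le> p x + p y" by simp
  next
    fix n :: nat and x :: 'a assume n: "n > 0"
    show "real n * p x \<le> p (real n *\<^sub>R x)"
    proof (rule ge)
      fix q assume q: "q \<in> Q"
      \<comment> \<open>Rational scalars are used here: a competitor \<open>q\<close> for
        \<open>n x\<close> becomes the competitor \<open>q / n\<close> for \<open>x\<close>.\<close>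
      have q': "(1 / real n) *\<^sub>R q \<in> Q" using q by (intro Qs) auto
      have scale: "real k *\<^sub>R r \<in> Q \<and> g (real k *\<^sub>R r) = real k * g r" if "r \<in> Q" for k r
      proof (induction k)
        case (Suc k)
        then show ?case using g(1)[OF that, of "real k *\<^sub>R r"] Qa[OF that, of "real k *\<^sub>R r"]
          by (simp add: algebra_simps)
      qed (simp add: Q0 g0)
      have "real n * p x \<le> real n * (norm (x - (1 / real n) *\<^sub>R q) + g ((1 / real n) *\<^sub>R q))"
        by (intro mult_left_mono le q') simp
      also have "\<dots> = norm (real n *\<^sub>R (x - (1 / real n) *\<^sub>R q)) + g (real n *\<^sub>R (1 / real n) *\<^sub>R q)"
        using scale[OF q', of n] by (simp only: norm_scaleR) (simp add: distrib_left)
      also have "\<dots> = norm (real n *\<^sub>R x - q) + g q" using n by (simp add: scaleR_diff_right)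
      finally show "real n * p x \<le> norm (real n *\<^sub>R x - q) + g q" .
    qed
  next
    show "p x \<le> norm x" for x using le[OF Q0, of x] g0 by simp
  qed
qed

text \<open>A functional below the infimal convolution lies below \<open>g\<close> on
  \<open>Q\<close>; since \<open>- q\<close> is in \<open>Q\<close> and \<open>g\<close> is odd
  there, the inequalities at \<open>q\<close> and \<open>- q\<close> combine to equality.\<close>

lemma rational_subspace_extension:
  fixes g :: "'a::real_normed_vector \<Rightarrow> real"
  assumes Q: "rational_subspace Q"
    and g: "\<And>x y. x \<in> Q \<Longrightarrow> y \<in> Q \<Longrightarrow> g (x + y) = g x + g y" "\<And>x. x \<in> Q \<Longrightarrow> - norm x \<le> g x"
  obtains \<phi> :: "'a \<Rightarrow>\<^sub>L real" where "norm \<phi> \<le> 1" "\<And>q. q \<in> Q \<Longrightarrow> blinfun_apply \<phi> q = g q"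
proof -
  obtain \<phi> :: "'a \<Rightarrow>\<^sub>L real" where \<phi>: "\<And>x. blinfun_apply \<phi> x \<le> (INF q\<in>Q. norm (x - q) + g q)"
    using hahn_banach_subnorm[OF subnorm_extension(1)[OF Q g]] by blast
  have "blinfun_apply \<phi> x \<le> norm x" for x
    using \<phi>[of x] subnormD(3)[OF subnorm_extension(1)[OF Q g], of x] by simp
  then have "norm \<phi> \<le> 1" by (rule norm_blinfun_le_1)
  moreover have "blinfun_apply \<phi> q = g q" if q: "q \<in> Q" for q
  proof -
    have "(-1::real) \<in> \<rat>" by simp
    with Q q have "(-1) *\<^sub>R q \<in> Q" unfolding rational_subspace_def by blast
    then have q': "- q \<in> Q" by simp
    have 0: "g (- q) = - g q" using g(1)[OF q q'] g(1)[of 0 0] Q by (simp add: rational_subspace_def)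
    have "blinfun_apply \<phi> r \<le> g r" if "r \<in> Q" for r
      using order_trans[OF \<phi> subnorm_extension(2)[OF Q g that, of r]] by simp
    from this[OF q] this[OF q'] 0 show ?thesis by (simp add: blinfun.minus_right)
  qed
  ultimately show thesis by (rule that)
qed

text \<open>Mazur's theorem for subspaces: the distance to \<open>Q\<close> is a subnorm, and a
  functional supporting it at \<open>y\<close> is nonpositive on \<open>closure Q\<close>, hence
  also at the weak limit \<open>y\<close>, where it equals the distance.\<close>

lemma weak_limit_in_closure:
  fixes y :: "'a::real_normed_vector"
  assumes Q: "rational_subspace Q" and x: "\<And>n. x n \<in> closure Q"
    and lim: "\<And>\<phi> :: 'a \<Rightarrow>\<^sub>L real. (\<lambda>n. blinfun_apply \<phi> (x n)) \<longlonglongrightarrow> blinfun_apply \<phi> y"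
  shows "y \<in> closure Q"
proof -
  let ?p = "\<lambda>x. INF q\<in>Q. norm (x - q) + (\<lambda>_. 0) q"
  have p: "subnorm ?p" "\<And>q x. q \<in> Q \<Longrightarrow> ?p x \<le> norm (x - q) + (\<lambda>_. 0) q"
    by (rule subnorm_extension[OF Q]; simp)+
  have ne: "Q \<noteq> {}" using Q by (auto simp: rational_subspace_def)
  obtain \<phi> :: "'a \<Rightarrow>\<^sub>L real" where \<phi>: "\<And>x. blinfun_apply \<phi> x \<le> ?p x" "blinfun_apply \<phi> y = ?p y"
    using hahn_banach_support[OF p(1), of y] by blast
  have "blinfun_apply \<phi> q \<le> 0" if "q \<in> Q" for q
    using \<phi>(1)[of q] p(2)[OF that, of q] by simp
  moreover have "closed {z. blinfun_apply \<phi> z \<le> 0}"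
    by (intro closed_Collect_le continuous_intros)
  ultimately have "closure Q \<subseteq> {z. blinfun_apply \<phi> z \<le> 0}" by (intro closure_minimal) auto
  with x have "blinfun_apply \<phi> (x n) \<le> 0" for n by blast
  then have "blinfun_apply \<phi> y \<le> 0" by (intro LIMSEQ_le_const2[OF lim[of \<phi>]]) auto
  then have "?p y \<le> 0" using \<phi> by simp
  then have "infdist y Q \<le> 0" using ne by (simp add: infdist_def dist_norm)
  then show ?thesis using ne infdist_nonneg[of y Q] by (simp add: in_closure_iff_infdist_zero)
qed

text \<open>Banach-Steinhaus by Baire category, the point where completeness of the domain enters.
  If some \<open>E n\<close> contains the ball of radius \<open>r\<close> about \<open>v\<close>,
  every \<open>T\<close> is bounded by \<open>2 * n\<close> on vectors of norm \<open>r\<close>,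
  because these are differences of two points of the ball.\<close>

lemma uniform_boundedness:
  fixes H :: "('f::banach \<Rightarrow>\<^sub>L 'g::real_normed_vector) set"
  assumes pw: "\<And>v. \<exists>C. \<forall>T\<in>H. norm (blinfun_apply T v) \<le> C"
  obtains W where "W \<ge> 0" "\<And>T. T \<in> H \<Longrightarrow> norm T \<le> W"
proof -
  define E where "E n = (\<Inter>T\<in>H. {v. norm (blinfun_apply T v) \<le> real n})" for n :: nat
  have closed: "closed (E n)" for n
    unfolding E_def by (intro closed_INT ballI closed_Collect_le continuous_intros)
  have cover: "(\<Union>n. E n) = UNIV"
  proof -
    have "\<exists>n. v \<in> E n" for v
    proof -
      obtain C where C: "\<forall>T\<in>H. norm (blinfun_apply T v) \<le> C" using pw by blast
      obtain n :: nat where "C \<le> real n" using real_arch_simple by blast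
      with C have "v \<in> E n" by (force simp: E_def)
      then show ?thesis ..
    qed
    then show ?thesis by auto
  qed
  have "\<exists>n. interior (E n) \<noteq> {}"
  proof (rule ccontr)
    assume "\<nexists>n. interior (E n) \<noteq> {}"
    then have "euclidean interior_of \<Union>(range E) = {}"
      using closed by (intro Baire_category_alt disjI1 completely_metrizable_space_euclidean) auto
    then show False using cover by simp
  qed
  then obtain n v where "v \<in> interior (E n)" by blast
  then obtain r where r: "r > 0" "cball v r \<subseteq> E n" using mem_interior_cball by blast
  have bound: "norm T \<le> 2 * real n / r" if T: "T \<in> H" for T
  proof (rule norm_blinfun_bound)
    fix x
    show "norm (blinfun_apply T x) \<le> 2 * real n / r * norm x"
    proof (cases "x = 0")
      case False
      define u where "u = (r / norm x) *\<^sub>R x"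
      have "norm u = r" using r(1) False by (simp add: u_def)
      then have "v + u \<in> E n" "v \<in> E n" using r by (auto intro!: subsetD[OF r(2)] simp: dist_norm)
      then have "norm (blinfun_apply T (v + u)) \<le> n" "norm (blinfun_apply T v) \<le> n"
        using T by (auto simp: E_def)
      moreover have "blinfun_apply T u = blinfun_apply T (v + u) - blinfun_apply T v"
        by (simp add: blinfun.add_right)
      ultimately have "norm (blinfun_apply T u) \<le> 2 * real n"
        using norm_triangle_ineq4[of "blinfun_apply T (v + u)" "blinfun_apply T v"] by simp
      then have "r / norm x * norm (blinfun_apply T x) \<le> 2 * real n"
        using r(1) by (simp add: u_def blinfun.scaleR_right)
      then show ?thesis using r(1) False by (simp add: field_simps)
    qed simp
  qed (use r in simp)
  show thesis by (rule that[of "2 * real n / r"]) (use r bound in auto)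
qed

text \<open>The norm of a functional need not be attained, so half of it is taken. The vector
  absorbs the sign of \<open>T y\<close>, so that the bound concerns \<open>T x\<close> itself; sums
  of norms can then be replaced by sums of values.\<close>

lemma half_norming_vector:
  fixes T :: "'a::real_normed_vector \<Rightarrow>\<^sub>L real"
  obtains x where "norm x \<le> 1" "norm T \<le> 2 * blinfun_apply T x"
proof (cases "T = 0")
  case True
  then show thesis by (intro that[of 0]) auto
next
  case False
  have "\<exists>y. norm T / 2 * norm y < norm (blinfun_apply T y)"
  proof (rule ccontr)
    assume "\<not> ?thesis"
    then have "norm (blinfun_apply T y) \<le> norm T / 2 * norm y" for y by (metis not_less)
    then have "norm T \<le> norm T / 2" by (intro norm_blinfun_bound) auto
    with False show False by simp
  qed
  then obtain y where y: "norm T / 2 * norm y < norm (blinfun_apply T y)" by blast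
  then have "y \<noteq> 0" by auto
  let ?x = "(sgn (blinfun_apply T y) / norm y) *\<^sub>R y"
  have "norm ?x \<le> 1" by (simp add: abs_sgn_eq)
  moreover have "blinfun_apply T ?x = norm (blinfun_apply T y) / norm y"
    by (cases "blinfun_apply T y" "0::real" rule: linorder_cases) (auto simp: blinfun.scaleR_right blinfun.minus_right)
  moreover have "norm T \<le> 2 * (norm (blinfun_apply T y) / norm y)"
    using y \<open>y \<noteq> 0\<close> by (simp add: field_simps)
  ultimately show thesis by (intro that[of ?x]) simp_all
qed

section \<open>Variation and weak densities of dual-valued measures\<close>

locale real_i_measure = sigma_algebra Z \<MM>
  for Z :: "'z set" and \<MM> +
  fixes \<nu> :: "'z set \<Rightarrow> ('e::real_normed_vector \<Rightarrow>\<^sub>L real)"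
  assumes i_measure: "i_measure scaleR (*) \<MM> \<nu>"
begin

lemma sums_apply:
  assumes "range A \<subseteq> \<MM>" "disjoint_family A"
  shows "(\<lambda>n. blinfun_apply (\<nu> (A n)) x) sums blinfun_apply (\<nu> (\<Union>n. A n)) x"
  using i_measure assms unfolding i_measure_def by blast

lemma measure_empty [simp]: "\<nu> {} = 0"
proof (rule blinfun_eqI)
  fix x
  have "summable (\<lambda>n::nat. blinfun_apply (\<nu> {}) x)"
    using sums_apply[of "\<lambda>_. {}" x] by (auto simp: disjoint_family_on_def sums_iff)
  then show "blinfun_apply (\<nu> {}) x = blinfun_apply 0 x" by (simp add: summable_const_iff)
qed

lemma measure_Un:
  assumes "A \<in> \<MM>" "B \<in> \<MM>" "A \<inter> B = {}"
  shows "\<nu> (A \<union> B) = \<nu> A + \<nu> B"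
proof (rule blinfun_eqI)
  fix x
  have "(\<lambda>n. blinfun_apply (\<nu> (binaryset A B n)) x) sums (blinfun_apply (\<nu> A) x + blinfun_apply (\<nu> B) x)"
    by (rule binaryset_sums) simp
  moreover have "(\<lambda>n. blinfun_apply (\<nu> (binaryset A B n)) x) sums blinfun_apply (\<nu> (\<Union>n. binaryset A B n)) x"
    using assms by (intro sums_apply)
      (auto simp: range_binaryset_eq disjoint_family_on_def binaryset_def)
  ultimately show "blinfun_apply (\<nu> (A \<union> B)) x = blinfun_apply (\<nu> A + \<nu> B) x"
    using sums_unique2 by (fastforce simp: UN_binaryset_eq blinfun.add_left)
qed

lemma measure_Union:
  assumes "finite P" "P \<subseteq> \<MM>" "disjoint P"
  shows "\<nu> (\<Union>P) = (\<Sum>B\<in>P. \<nu> B)"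
  using assms
proof (induction P)
  case (insert B P)
  have "B \<inter> \<Union>P = {}" using insert.prems(2) insert.hyps(2) by (auto simp: disjoint_def)
  moreover have "\<Union>P \<in> \<MM>" using insert by (intro finite_Union) auto
  ultimately show ?case using insert by (simp add: measure_Un pairwise_insert disjoint_def)
qed simp

text \<open>Half-norming vectors form a bounded sequence, so independent convergence may be tested
  on them. Their values are at least half the norms, and convergence of this one series becomes
  absolute convergence in norm.\<close>

lemma summable_norm:
  assumes "range A \<subseteq> \<MM>" "disjoint_family A"
  shows "summable (\<lambda>n. norm (\<nu> (A n)))"
proof -
  have "\<exists>x. norm x \<le> 1 \<and> norm (\<nu> (A n)) \<le> 2 * blinfun_apply (\<nu> (A n)) x" for n
    using half_norming_vector[of "\<nu> (A n)"] by blast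
  then obtain x where x: "\<And>n. norm (x n) \<le> 1" "\<And>n. norm (\<nu> (A n)) \<le> 2 * blinfun_apply (\<nu> (A n)) (x n)"
    by metis
  have "bounded (range x)" using x(1) by (auto simp: bounded_iff)
  then have "summable (\<lambda>n. blinfun_apply (\<nu> (A n)) (x n))"
    using i_measure assms unfolding i_measure_def independently_convergent_def by blast
  then have "summable (\<lambda>n. 2 * blinfun_apply (\<nu> (A n)) (x n))" by (rule summable_mult)
  then show ?thesis by (rule summable_comparison_test') (use x(2) in simp)
qed

section \<open>Total variation of a dual-valued measure\<close>

definition families :: "'z set \<Rightarrow> 'z set set set" where
  "families A = {P. finite P \<and> P \<subseteq> \<MM> \<and> disjoint P \<and> \<Union>P \<subseteq> A}"

text \<open>Finite disjoint families inside \<open>A\<close> replace partitions of \<open>A\<close>,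
  so that families can be united or cut down without adding remainders. Values lie in
  \<open>ennreal\<close> because finiteness is obtained only after countable additivity.\<close>

definition variation :: "'z set \<Rightarrow> ennreal" where
  "variation A = (SUP P\<in>families A. \<Sum>B\<in>P. ennreal (norm (\<nu> B)))"

lemma variation_upper: "P \<in> families A \<Longrightarrow> (\<Sum>B\<in>P. ennreal (norm (\<nu> B))) \<le> variation A"
  unfolding variation_def by (rule SUP_upper)

lemma families_nonempty: "families A \<noteq> {}"
  by (auto simp: families_def intro!: exI[of _ "{}"])

lemma variation_empty: "variation {} = 0"
proof -
  have "(\<Sum>B\<in>P. ennreal (norm (\<nu> B))) = 0" if "P \<in> families {}" for P
    using that by (intro sum.neutral) (auto simp: families_def)
  then show ?thesis using families_nonempty[of "{}"] by (simp add: variation_def)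
qed

lemma variation_superadditive:
  assumes "A \<inter> B = {}"
  shows "variation A + variation B \<le> variation (A \<union> B)"
proof -
  let ?s = "\<lambda>P. \<Sum>B\<in>P. ennreal (norm (\<nu> B))"
  have "?s P + ?s Q \<le> variation (A \<union> B)" if P: "P \<in> families A" and Q: "Q \<in> families B" for P Q
  proof -
    \<comment> \<open>The empty set may belong to both families; it is the only possible common
      member and counts zero, so the two sums add up.\<close>
    have "C = {}" if "C \<in> P \<inter> Q" for C
      using that P Q assms unfolding families_def by blast
    then have "\<nu> C = 0" if "C \<in> P \<inter> Q" for C using that measure_empty by metis
    then have "?s (P \<inter> Q) = 0" by (intro sum.neutral) auto
    then have "?s P + ?s Q = ?s (P \<union> Q)"
      using P Q sum.union_inter[of P Q "\<lambda>B. ennreal (norm (\<nu> B))"] by (simp add: families_def)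
    also have "C \<inter> D = {}" if "C \<in> P" "D \<in> Q" for C D
      using that P Q assms unfolding families_def by blast
    then have "disjoint (P \<union> Q)"
      using P Q by (intro disjoint_union) (auto simp: families_def)
    then have "P \<union> Q \<in> families (A \<union> B)"
      using P Q unfolding families_def by auto
    then have "?s (P \<union> Q) \<le> variation (A \<union> B)" by (rule variation_upper)
    finally show ?thesis .
  qed
  then have "(SUP P\<in>families A. ?s P + ?s Q) \<le> variation (A \<union> B)" if "Q \<in> families B" for Q
    using that by (intro SUP_least)
  then have "variation A + ?s Q \<le> variation (A \<union> B)" if "Q \<in> families B" for Q
    using that by (simp add: variation_def ennreal_SUP_add_left[OF families_nonempty])
  then have "(SUP Q\<in>families B. variation A + ?s Q) \<le> variation (A \<union> B)"
    by (intro SUP_least)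
  then show ?thesis
    by (simp add: variation_def[of B] ennreal_SUP_add_right[OF families_nonempty])
qed

lemma families_restrict:
  assumes P: "P \<in> families B" and A: "A \<in> \<MM>"
  shows "(\<lambda>B. B \<inter> A) ` P \<in> families A"
proof -
  have "(B \<inter> A) \<inter> (C \<inter> A) = {}" if "B \<in> P" "C \<in> P" "B \<inter> A \<noteq> C \<inter> A" for B C
  proof -
    have "B \<inter> C = {}" using that P by (auto simp: families_def disjoint_def)
    then show ?thesis by blast
  qed
  then show ?thesis using P A by (auto simp: families_def disjoint_def)
qed

text \<open>The series for \<open>\<nu> B\<close> is only known to converge at each
  \<open>x\<close>. Norm summability of the pieces bounds all these series by one multiple of
  \<open>norm x\<close>, hence the operator norm.\<close>

lemma norm_le_suminf:
  assumes A: "range A \<subseteq> \<MM>" "disjoint_family A" and B: "B \<in> \<MM>" "B \<subseteq> (\<Union>n. A n)"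
  shows "ennreal (norm (\<nu> B)) \<le> (\<Sum>n. ennreal (norm (\<nu> (B \<inter> A n))))"
proof -
  have BA: "range (\<lambda>n. B \<inter> A n) \<subseteq> \<MM>" "disjoint_family (\<lambda>n. B \<inter> A n)"
    using A B(1) by (auto simp: disjoint_family_on_def)
  have un: "(\<Union>n. B \<inter> A n) = B" using B(2) by auto
  note summable = summable_norm[OF BA]
  have "norm (\<nu> B) \<le> (\<Sum>n. norm (\<nu> (B \<inter> A n)))"
  proof (rule norm_blinfun_bound)
    fix x
    have "norm (blinfun_apply (\<nu> B) x) \<le> (\<Sum>n. norm (\<nu> (B \<inter> A n)) * norm x)"
    proof (rule order_trans[OF _ suminf_le])
      have sm: "summable (\<lambda>n. norm (blinfun_apply (\<nu> (B \<inter> A n)) x))"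
      proof (rule summable_comparison_test'[OF summable_mult2[OF summable, of "norm x"]])
        show "norm (norm (blinfun_apply (\<nu> (B \<inter> A n)) x)) \<le> norm (\<nu> (B \<inter> A n)) * norm x" for n
          using norm_blinfun[of "\<nu> (B \<inter> A n)" x] by simp
      qed
      show "norm (blinfun_apply (\<nu> B) x) \<le> (\<Sum>n. norm (blinfun_apply (\<nu> (B \<inter> A n)) x))"
        using sums_apply[OF BA, of x] Series.summable_norm[OF sm] unfolding un sums_iff by simp
      show "summable (\<lambda>n. norm (blinfun_apply (\<nu> (B \<inter> A n)) x))" by (rule sm)
      show "summable (\<lambda>n. norm (\<nu> (B \<inter> A n)) * norm x)" by (rule summable_mult2[OF summable])
    qed (rule norm_blinfun)
    then show "norm (blinfun_apply (\<nu> B) x) \<le> (\<Sum>n. norm (\<nu> (B \<inter> A n))) * norm x"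
      by (simp add: suminf_mult2[OF summable])
  qed (simp add: suminf_nonneg summable)
  then show ?thesis by (subst suminf_ennreal2) (auto simp: summable intro: ennreal_leI)
qed

text \<open>One inequality is superadditivity along finite unions. For the other, each member of a
  finite family is cut along the \<open>A n\<close>, and the finite sum is exchanged with the
  series.\<close>

lemma variation_countably_additive: "countably_additive \<MM> variation"
proof (rule countably_additiveI)
  fix A :: "nat \<Rightarrow> 'z set" assume A: "range A \<subseteq> \<MM>" "disjoint_family A"
  let ?s = "\<lambda>P. \<Sum>B\<in>P. ennreal (norm (\<nu> B))"
  have mono: "variation B \<le> variation C" if "B \<subseteq> C" for B C
    unfolding variation_def by (rule SUP_subset_mono) (use that in \<open>auto simp: families_def\<close>)
  have "(\<Sum>i<n. variation (A i)) \<le> variation (\<Union>i<n. A i)" for n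
  proof (induction n)
    case (Suc n)
    have "A i \<inter> A n = {}" if "i < n" for i
      by (rule disjoint_family_onD[OF A(2)]) (use that in auto)
    then have "(\<Union>i<n. A i) \<inter> A n = {}" by blast
    then have "variation (\<Union>i<n. A i) + variation (A n) \<le> variation ((\<Union>i<n. A i) \<union> A n)"
      by (rule variation_superadditive)
    also have "(\<Union>i<n. A i) \<union> A n = (\<Union>i<Suc n. A i)" by (auto simp: less_Suc_eq)
    finally have "variation (\<Union>i<n. A i) + variation (A n) \<le> variation (\<Union>i<Suc n. A i)" .
    from order_trans[OF add_right_mono[OF Suc, of "variation (A n)"] this] show ?case
      by (simp only: sum.lessThan_Suc)
  qed (simp add: variation_empty)
  also have "variation (\<Union>i<n. A i) \<le> variation (\<Union>i. A i)" for n by (intro mono) auto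
  finally have "(\<Sum>i. variation (A i)) \<le> variation (\<Union>i. A i)"
    unfolding suminf_eq_SUP by (intro SUP_least)
  moreover have "variation (\<Union>i. A i) \<le> (\<Sum>i. variation (A i))"
    unfolding variation_def[of "\<Union>i. A i"]
  proof (rule SUP_least)
    fix P assume P: "P \<in> families (\<Union>i. A i)"
    have "?s P \<le> (\<Sum>B\<in>P. \<Sum>n. ennreal (norm (\<nu> (B \<inter> A n))))"
      using P by (intro sum_mono norm_le_suminf A) (auto simp: families_def)
    also have "\<dots> = (\<Sum>n. \<Sum>B\<in>P. ennreal (norm (\<nu> (B \<inter> A n))))"
      by (rule suminf_sum[symmetric]) simp
    also have "\<dots> \<le> (\<Sum>n. variation (A n))"
    proof (intro suminf_le)
      fix n
      have "(\<Sum>B\<in>P. ennreal (norm (\<nu> (B \<inter> A n)))) = ?s ((\<lambda>B. B \<inter> A n) ` P)"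
      \<comment> \<open>Different members of \<open>P\<close> can share a trace on
        \<open>A n\<close> only if it is empty, and then the summand vanishes.\<close>
      proof (rule sum.reindex_nontrivial[symmetric, unfolded o_def])
        show "finite P" using P by (simp add: families_def)
        fix B C assume "B \<in> P" "C \<in> P" "B \<noteq> C" and eq: "B \<inter> A n = C \<inter> A n"
        then have "B \<inter> C = {}" using P by (auto simp: families_def disjoint_def)
        then have "B \<inter> A n = {}" using eq by blast
        then show "ennreal (norm (\<nu> (B \<inter> A n))) = 0" by simp
      qed
      also have "(\<lambda>B. B \<inter> A n) ` P \<in> families (A n)"
        using P A(1) by (intro families_restrict) auto
      then have "?s ((\<lambda>B. B \<inter> A n) ` P) \<le> variation (A n)" by (rule variation_upper)
      finally show "(\<Sum>B\<in>P. ennreal (norm (\<nu> (B \<inter> A n)))) \<le> variation (A n)" .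
    qed auto
    finally show "?s P \<le> (\<Sum>n. variation (A n))" .
  qed
  ultimately show "(\<Sum>i. variation (A i)) = variation (\<Union>i. A i)" by (rule antisym)
qed

section \<open>The variation as a finite measure\<close>

definition var_measure :: "'z measure" where
  "var_measure = measure_of Z \<MM> variation"

lemma sets_var_measure [simp]: "sets var_measure = \<MM>"
  by (simp add: var_measure_def sets_measure_of[OF space_closed] sigma_sets_eq)

lemma space_var_measure [simp]: "space var_measure = Z"
  by (simp add: var_measure_def space_measure_of[OF space_closed])

lemma emeasure_var_measure: "A \<in> \<MM> \<Longrightarrow> emeasure var_measure A = variation A"
  unfolding var_measure_def
  by (rule emeasure_measure_of_sigma)
    (auto simp: positive_def variation_empty variation_countably_additive sigma_algebra_axioms)

text \<open>In a partition with \<open>\<Sum>\<parallel>\<nu> B\<parallel> > \<parallel>\<nu> A\<parallel> + 2\<close> some piece \<open>C\<close> has infinite variation; as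
\<open>\<parallel>\<nu> C\<parallel>\<close> is at most \<open>\<parallel>\<nu> A\<parallel>\<close> plus the sum over the other pieces, that sum is at least 1.\<close>

lemma infinite_variation_split:
  assumes A: "A \<in> \<MM>" "variation A = top"
  obtains P C where "P \<in> families (A - C)" "{} \<notin> P" "1 \<le> (\<Sum>B\<in>P. norm (\<nu> B))"
    "C \<in> \<MM>" "C \<subseteq> A" "variation C = top"
proof -
  have "ennreal (norm (\<nu> A) + 2) < variation A" using A by simp
  then obtain P0 where P0: "P0 \<in> families A" "ennreal (norm (\<nu> A) + 2) < (\<Sum>B\<in>P0. ennreal (norm (\<nu> B)))"
    unfolding variation_def less_SUP_iff by blast
  have P0': "finite P0" "P0 \<subseteq> \<MM>" "disjoint P0" "\<Union>P0 \<subseteq> A" using P0(1) by (auto simp: families_def)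
  have UP0: "\<Union>P0 \<in> \<MM>" using P0' by (intro finite_Union) auto
  \<comment> \<open>Adding the remainder gives a partition of \<open>A\<close>, over which both the
    variation and \<open>\<nu>\<close> can be summed.\<close>
  define P where "P = insert (A - \<Union>P0) P0"
  have fin: "finite P" and sub: "P \<subseteq> \<MM>" and dis: "disjoint P" and un: "\<Union>P = A"
    using P0' A(1) UP0 by (auto simp: P_def disjoint_def)
  have "(\<Sum>B\<in>P0. norm (\<nu> B)) > norm (\<nu> A) + 2"
    using P0(2) by (simp add: sum_ennreal ennreal_less_iff del: ennreal_plus)
  also have "(\<Sum>B\<in>P0. norm (\<nu> B)) \<le> (\<Sum>B\<in>P. norm (\<nu> B))"
    using fin by (intro sum_mono2) (auto simp: P_def)
  finally have big: "norm (\<nu> A) + 2 < (\<Sum>B\<in>P. norm (\<nu> B))" .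
  have "variation A = (\<Sum>B\<in>P. variation B)"
  proof -
    have "(\<Sum>B\<in>P. emeasure var_measure B) = emeasure var_measure (\<Union>B\<in>P. B)"
      using fin sub dis by (intro sum_emeasure) (auto simp: disjoint_family_on_def disjoint_def)
    moreover have "(\<Sum>B\<in>P. emeasure var_measure B) = (\<Sum>B\<in>P. variation B)"
      using sub by (intro sum.cong) (auto simp: emeasure_var_measure)
    ultimately show ?thesis using un A(1) by (simp add: emeasure_var_measure)
  qed
  then have "(\<Sum>B\<in>P. variation B) = top" using A(2) by simp
  then obtain C where C: "C \<in> P" "variation C = top"
    using fin by (metis ennreal_sum_eq_top)
  have "(\<Sum>B\<in>P. \<nu> B) = \<nu> A" using measure_Union[OF fin sub dis] un by simp
  then have "\<nu> C = \<nu> A - (\<Sum>B\<in>P - {C}. \<nu> B)"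
    using sum.remove[OF fin C(1), of \<nu>] by (simp add: algebra_simps)
  then have "norm (\<nu> C) \<le> norm (\<nu> A) + (\<Sum>B\<in>P - {C}. norm (\<nu> B))"
    using norm_triangle_ineq4[of "\<nu> A" "\<Sum>B\<in>P - {C}. \<nu> B"] norm_sum[of \<nu> "P - {C}"] by simp
  with big have "1 \<le> (\<Sum>B\<in>P - {C}. norm (\<nu> B))"
    using sum.remove[OF fin C(1), of "\<lambda>B. norm (\<nu> B)"] by simp
  \<comment> \<open>Without the empty set, families from disjoint regions have no member in common,
    which the later summation over all stages relies on.\<close>
  also have "\<dots> = (\<Sum>B\<in>P - {C} - {{}}. norm (\<nu> B))"
    using fin by (intro sum.mono_neutral_right) auto
  finally have "1 \<le> (\<Sum>B\<in>P - {C} - {{}}. norm (\<nu> B))" .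
  moreover have "P - {C} - {{}} \<in> families (A - C)"
    using fin sub dis un C(1) by (auto simp: families_def disjoint_def)
  ultimately show thesis using C sub un by (intro that[of "P - {C} - {{}}" C]) auto
qed

text \<open>Families gathered over infinitely many stages form a countable set of sets, whereas norm
  summability speaks of sequences.\<close>

lemma sum_norm_bounded:
  assumes G: "countable G" "G \<subseteq> \<MM>" "disjoint G"
  obtains K where "\<And>F. finite F \<Longrightarrow> F \<subseteq> G \<Longrightarrow> (\<Sum>B\<in>F. norm (\<nu> B)) \<le> K"
proof -
  \<comment> \<open>numbering the members of \<open>G\<close>, with \<open>{}\<close> at unused indices so that no member is repeated\<close>
  let ?h = "to_nat_on G"
  define A where "A k = \<Union>{B \<in> G. ?h B = k}" for k
  have inj: "inj_on ?h G" using G(1) by (rule inj_on_to_nat_on)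
  have A_h: "A (?h B) = B" if "B \<in> G" for B
    using that inj by (auto simp: A_def dest: inj_onD)
  have A_cases: "A k = {} \<or> (\<exists>B\<in>G. ?h B = k \<and> A k = B)" for k
    using A_h by (cases "k \<in> ?h ` G") (auto simp: A_def)
  have "range A \<subseteq> \<MM>"
  proof
    fix X assume "X \<in> range A"
    then obtain k where "X = A k" by blast
    then show "X \<in> \<MM>" using A_cases[of k] G(2) by auto
  qed
  moreover have "disjoint_family A"
    unfolding disjoint_family_on_def
  proof (intro ballI impI)
    fix k l :: nat assume "k \<noteq> l"
    then have "B \<inter> C = {}" if "B \<in> G" "?h B = k" "C \<in> G" "?h C = l" for B C
    proof -
      have "B \<noteq> C" using that \<open>k \<noteq> l\<close> by auto
      then show ?thesis using G(3) that unfolding disjoint_def by blast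
    qed
    then show "A k \<inter> A l = {}" by (auto simp: A_def)
  qed
  ultimately have sm: "summable (\<lambda>n. norm (\<nu> (A n)))" by (rule summable_norm)
  show thesis
  proof (rule that)
    fix F assume F: "finite F" "F \<subseteq> G"
    have "(\<Sum>B\<in>F. norm (\<nu> B)) = (\<Sum>B\<in>F. norm (\<nu> (A (?h B))))"
      using F A_h by (intro sum.cong) auto
    also have "\<dots> = (\<Sum>k\<in>?h ` F. norm (\<nu> (A k)))"
      using inj_on_subset[OF inj F(2)] by (simp add: sum.reindex)
    also have "\<dots> \<le> (\<Sum>k. norm (\<nu> (A k)))"
      using F by (intro sum_le_suminf sm) auto
    finally show "(\<Sum>B\<in>F. norm (\<nu> B)) \<le> (\<Sum>k. norm (\<nu> (A k)))" .
  qed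
qed

text \<open>If the variation were infinite, the split could be repeated inside the piece that keeps
  infinite variation, and each difference \<open>C n - C (Suc n)\<close> would carry a finite family
  with norms summing to at least \<open>1\<close>. Together they form one countable disjoint family
  with unbounded finite sums.\<close>

lemma variation_finite: "variation Z < top"
proof (rule ccontr)
  assume "\<not> variation Z < top"
  then have Z: "variation Z = top" using less_top by blast
  let ?bad = "\<lambda>A. A \<in> \<MM> \<and> variation A = top"
  have "\<exists>C. \<forall>n. ?bad (C n) \<and> (C (Suc n) \<subseteq> C n \<and>
      (\<exists>P. P \<in> families (C n - C (Suc n)) \<and> {} \<notin> P \<and> 1 \<le> (\<Sum>B\<in>P. norm (\<nu> B))))"
  proof (rule dependent_nat_choice)
    show "\<exists>A. ?bad A" using Z by blast
    fix A and n :: nat assume "?bad A"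
    then obtain P C where "P \<in> families (A - C)" "{} \<notin> P" "1 \<le> (\<Sum>B\<in>P. norm (\<nu> B))"
      "C \<in> \<MM>" "C \<subseteq> A" "variation C = top" using infinite_variation_split[of A] by blast
    then show "\<exists>y. ?bad y \<and> (y \<subseteq> A \<and>
      (\<exists>P. P \<in> families (A - y) \<and> {} \<notin> P \<and> 1 \<le> (\<Sum>B\<in>P. norm (\<nu> B))))" by blast
  qed
  then obtain C where C: "\<And>n. C (Suc n) \<subseteq> C n"
      "\<And>n. \<exists>P. P \<in> families (C n - C (Suc n)) \<and> {} \<notin> P \<and> 1 \<le> (\<Sum>B\<in>P. norm (\<nu> B))"
    by blast
  from C(2) obtain P where P: "\<And>n. P n \<in> families (C n - C (Suc n))" "\<And>n. {} \<notin> P n"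
      "\<And>n. 1 \<le> (\<Sum>B\<in>P n. norm (\<nu> B))" by metis
  have PD: "finite (P n)" "P n \<subseteq> \<MM>" "disjoint (P n)" "\<And>B. B \<in> P n \<Longrightarrow> B \<subseteq> C n - C (Suc n)" for n
    using P(1)[of n] by (auto simp: families_def)
  have dec: "C n \<subseteq> C m" if "m \<le> n" for m n by (rule lift_Suc_antimono_le[of C, OF C(1) that])
  have sep: "A \<inter> B = {}" if AB: "A \<in> P m" "B \<in> P n" "m < n" for A B m n
    using PD(4)[OF AB(1)] PD(4)[OF AB(2)] dec[of "Suc m" n] AB(3) by fastforce
  define G where "G = (\<Union>n. P n)"
  have "disjoint G"
    unfolding disjoint_def G_def
  proof (intro ballI impI)
    fix A B assume "A \<in> (\<Union>n. P n)" "B \<in> (\<Union>n. P n)" "A \<noteq> B"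
    then obtain m n where "A \<in> P m" "B \<in> P n" by blast
    with \<open>A \<noteq> B\<close> show "A \<inter> B = {}" using sep[of A m B n] sep[of B n A m] PD(3)[of n]
      by (cases m n rule: linorder_cases) (auto simp: disjoint_def)
  qed
  moreover have "countable G" using PD(1) by (auto simp: G_def countable_finite)
  moreover have "G \<subseteq> \<MM>" using PD(2) by (auto simp: G_def)
  ultimately obtain K where K: "\<And>F. finite F \<Longrightarrow> F \<subseteq> G \<Longrightarrow> (\<Sum>B\<in>F. norm (\<nu> B)) \<le> K"
    using sum_norm_bounded[of G] by blast
  have "real m \<le> K" for m
  proof -
    have "real m = (\<Sum>n<m. 1)" by simp
    also have "\<dots> \<le> (\<Sum>n<m. \<Sum>B\<in>P n. norm (\<nu> B))" by (intro sum_mono P(3))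
    also have "\<dots> = (\<Sum>B\<in>(\<Union>n<m. P n). norm (\<nu> B))"
    proof (rule sum.UNION_disjoint[symmetric])
      show "\<forall>i\<in>{..<m}. \<forall>j\<in>{..<m}. i \<noteq> j \<longrightarrow> P i \<inter> P j = {}"
      proof (intro ballI impI)
        fix i j :: nat assume "i \<noteq> j"
        have "B = {}" if "B \<in> P i" "B \<in> P j" for B
          using sep[of B i B j] sep[of B j B i] that \<open>i \<noteq> j\<close> by (cases i j rule: linorder_cases) auto
        with P(2) show "P i \<inter> P j = {}" by blast
      qed
    qed (auto simp: PD(1))
    also have "\<dots> \<le> K" by (rule K) (auto simp: PD(1) G_def)
    finally show ?thesis .
  qed
  then show False using reals_Archimedean2[of K] by (metis not_less)
qed

sublocale var: finite_measure var_measure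
  by (rule finite_measureI) (use variation_finite in \<open>simp add: emeasure_var_measure less_top\<close>)

lemma norm_le_variation: "A \<in> \<MM> \<Longrightarrow> norm (\<nu> A) \<le> measure var_measure A"
proof -
  assume A: "A \<in> \<MM>"
  then have "{A} \<in> families A" by (auto simp: families_def)
  then have "ennreal (norm (\<nu> A)) \<le> emeasure var_measure A"
    using variation_upper[of "{A}" A] A by (simp add: emeasure_var_measure)
  then show ?thesis by (simp add: var.emeasure_eq_measure)
qed

section \<open>Densities with respect to the variation\<close>

lemma Radon_Nikodym_apply:
  "\<exists>g. integrable var_measure g \<and>
    (\<forall>A\<in>\<MM>. blinfun_apply (\<nu> A) x = (LINT z:A|var_measure. g z))"
proof -
  let ?m = "measure var_measure"
  \<comment> \<open>shifted by a multiple of the variation so that it is a positive measure\<close>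
  let ?n = "\<lambda>A. blinfun_apply (\<nu> A) x + norm x * ?m A"
  have n_nonneg: "0 \<le> ?n A" if "A \<in> \<MM>" for A
  proof -
    have "\<bar>blinfun_apply (\<nu> A) x\<bar> \<le> ?m A * norm x"
      using norm_blinfun[of "\<nu> A" x] mult_right_mono[OF norm_le_variation[OF that], of "norm x"] by simp
    then show ?thesis by (simp add: mult.commute)
  qed
  define N where "N = measure_of Z \<MM> (\<lambda>A. ennreal (?n A))"
  have sets_N: "sets N = \<MM>"
    by (simp add: N_def sets_measure_of[OF space_closed] sigma_sets_eq)
  have emeasure_N: "emeasure N A = ennreal (?n A)" if "A \<in> \<MM>" for A
    unfolding N_def
  proof (rule emeasure_measure_of_sigma)
    show "countably_additive \<MM> (\<lambda>A. ennreal (?n A))"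
    proof (rule countably_additiveI)
      fix A :: "nat \<Rightarrow> 'z set" assume A: "range A \<subseteq> \<MM>" "disjoint_family A"
      have "(\<lambda>i. ?m (A i)) sums ?m (\<Union>i. A i)"
        using A by (intro var.finite_measure_UNION) auto
      then have "(\<lambda>i. ?n (A i)) sums ?n (\<Union>i. A i)"
        by (intro sums_add sums_apply A sums_mult)
      then show "(\<Sum>i. ennreal (?n (A i))) = ennreal (?n (\<Union>i. A i))"
        using A(1) n_nonneg by (subst suminf_ennreal2) (auto simp: sums_iff)
    qed
  qed (use that in \<open>auto simp: positive_def sigma_algebra_axioms\<close>)
  have "absolutely_continuous var_measure N"
    unfolding absolutely_continuous_def
  proof
    fix A assume A: "A \<in> null_sets var_measure"
    then have A': "A \<in> \<MM>" and m0: "?m A = 0" by (auto simp: measure_def null_sets_def)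
    have "\<nu> A = 0" using norm_le_variation[OF A'] m0 by simp
    then show "A \<in> null_sets N" using A' m0 by (simp add: null_sets_def sets_N emeasure_N)
  qed
  then obtain h where h: "h \<in> borel_measurable var_measure" "density var_measure h = N"
    using var.Radon_Nikodym[of N] sets_N by auto
  note h(1)[measurable]
  have nn_h: "(\<integral>\<^sup>+z. h z * indicator A z \<partial>var_measure) = ennreal (?n A)" if "A \<in> \<MM>" for A
    using emeasure_density[OF h(1), of A] that h(2) emeasure_N by simp
  have "(\<integral>\<^sup>+z. h z \<partial>var_measure) = (\<integral>\<^sup>+z. h z * indicator Z z \<partial>var_measure)"
    by (intro nn_integral_cong) (simp add: indicator_def)
  then have "(\<integral>\<^sup>+z. h z \<partial>var_measure) \<noteq> \<infinity>" using nn_h[of Z] by simp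
  then have fin: "AE z in var_measure. h z \<noteq> \<infinity>" by (rule nn_integral_PInf_AE[OF h(1)])
  \<comment> \<open>The density takes values in \<open>ennreal\<close>, but it is finite almost
    everywhere since \<open>N\<close> has finite total mass; a real-valued version may replace
    it.\<close>
  define k where "k z = enn2real (h z)" for z
  have k_meas [measurable]: "k \<in> borel_measurable var_measure" unfolding k_def[abs_def] by measurable
  have hk: "has_bochner_integral var_measure (\<lambda>z. k z * indicator A z) (?n A)" if A: "A \<in> \<MM>" for A
  proof (rule has_bochner_integral_nn_integral)
    have [measurable]: "A \<in> sets var_measure" using A by simp
    show "(\<lambda>z. k z * indicator A z) \<in> borel_measurable var_measure" by measurable
    show "0 \<le> ?n A" by (rule n_nonneg[OF A])
    have "(\<integral>\<^sup>+z. ennreal (k z * indicator A z) \<partial>var_measure) = (\<integral>\<^sup>+z. h z * indicator A z \<partial>var_measure)"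
      by (rule nn_integral_cong_AE, use fin in eventually_elim)
        (auto simp: k_def indicator_def less_top)
    then show "(\<integral>\<^sup>+z. ennreal (k z * indicator A z) \<partial>var_measure) = ennreal (?n A)"
      by (simp add: nn_h[OF A])
  qed (simp add: k_def)
  have "integrable var_measure (\<lambda>z. k z * indicator Z z)"
    using hk[of Z] by (simp add: has_bochner_integral_iff)
  then have int_k: "integrable var_measure k"
    by (rule Bochner_Integration.integrable_cong[THEN iffD1, rotated -1]) (auto simp: indicator_def)
  show ?thesis
  proof (intro exI conjI ballI)
    \<comment> \<open>The shift has constant density \<open>norm x\<close>, which is now taken off
      again.\<close>
    show "integrable var_measure (\<lambda>z. k z - norm x)" using int_k by simp
    fix A assume A: "A \<in> \<MM>"
    have "(LINT z:A|var_measure. k z - norm x) =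
        (LINT z|var_measure. k z * indicator A z) - (LINT z|var_measure. norm x * indicator A z)"
      unfolding set_lebesgue_integral_def using hk[OF A] A
      by (subst Bochner_Integration.integral_diff[symmetric])
        (auto simp: has_bochner_integral_iff algebra_simps var.emeasure_eq_measure
            intro!: integrable_mult_right integrable_real_indicator)
    also have "\<dots> = blinfun_apply (\<nu> A) x"
      using hk[OF A] A by (simp add: has_bochner_integral_iff)
    finally show "blinfun_apply (\<nu> A) x = (LINT z:A|var_measure. k z - norm x)" by simp
  qed
qed

text \<open>Chosen pointwise by Hahn-Banach, \<open>\<phi>\<close> has no evident measurability as a
  map into the dual; on \<open>Q\<close> it agrees with the measurable densities up to one null set,
  since countability of \<open>Q\<close> lets all exceptional sets be united.\<close>

lemma weak_density:
  assumes Q: "countable Q" "rational_subspace Q"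
  obtains \<phi> :: "'z \<Rightarrow> 'e \<Rightarrow>\<^sub>L real" where "\<And>z. norm (\<phi> z) \<le> 1"
    "\<And>q. q \<in> Q \<Longrightarrow> (\<lambda>z. blinfun_apply (\<phi> z) q) \<in> borel_measurable var_measure"
    "\<And>A q. A \<in> \<MM> \<Longrightarrow> q \<in> Q \<Longrightarrow> blinfun_apply (\<nu> A) q = (LINT z:A|var_measure. blinfun_apply (\<phi> z) q)"
proof -
  have "\<exists>G. \<forall>x. integrable var_measure (G x) \<and>
      (\<forall>A\<in>\<MM>. blinfun_apply (\<nu> A) x = (LINT z:A|var_measure. G x z))"
    by (intro choice allI Radon_Nikodym_apply)
  then obtain G where int_G: "\<And>x. integrable var_measure (G x)"
    and G: "\<And>x A. A \<in> \<MM> \<Longrightarrow> blinfun_apply (\<nu> A) x = (LINT z:A|var_measure. G x z)"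
    by blast
  have set_int: "set_integrable var_measure A (G x)" if "A \<in> \<MM>" for A x
    unfolding set_integrable_def using that int_G by (intro integrable_mult_indicator) auto
  have G_add: "AE z in var_measure. G (x + y) z = G x z + G y z" for x y
  proof (rule density_unique_real)
    fix A assume "A \<in> sets var_measure"
    then have A: "A \<in> \<MM>" by simp
    have "(LINT z:A|var_measure. G x z + G y z) = blinfun_apply (\<nu> A) x + blinfun_apply (\<nu> A) y"
      using set_int[OF A] by (simp add: set_integral_add G[OF A])
    then show "(LINT z:A|var_measure. G (x + y) z) = (LINT z:A|var_measure. G x z + G y z)"
      by (simp add: G[OF A, symmetric] blinfun.add_right)
  qed (use int_G in auto)
  \<comment> \<open>Additivity at \<open>- q\<close> turns this one-sided bound into a two-sided one
    when the densities are extended.\<close>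
  have G_lower: "AE z in var_measure. - norm x \<le> G x z" for x
  proof -
    have "AE z in var_measure. 0 \<le> G x z + norm x"
    proof (rule var.density_nonneg)
      fix A assume "A \<in> sets var_measure"
      then have A: "A \<in> \<MM>" by simp
      have "set_integrable var_measure A (\<lambda>_. norm x)"
        unfolding set_integrable_def using A by (intro integrable_mult_indicator) auto
      moreover have "(LINT z:A|var_measure. norm x) = measure var_measure A * norm x"
        using A by (simp add: set_lebesgue_integral_def)
      ultimately have "(LINT z:A|var_measure. G x z + norm x)
          = blinfun_apply (\<nu> A) x + measure var_measure A * norm x"
        using set_int[OF A] by (simp add: set_integral_add G[OF A])
      moreover have "\<bar>blinfun_apply (\<nu> A) x\<bar> \<le> measure var_measure A * norm x"
        using norm_blinfun[of "\<nu> A" x] mult_right_mono[OF norm_le_variation[OF A], of "norm x"] by simp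
      ultimately show "0 \<le> (LINT z:A|var_measure. G x z + norm x)" by simp
    qed (use int_G in simp)
    then show ?thesis by eventually_elim simp
  qed
  \<comment> \<open>The good set, of full measure. Off it the functional will be zero, so that the
    bound by \<open>1\<close> holds at every point.\<close>
  define N where "N = {z \<in> space var_measure. \<forall>q\<in>Q. (\<forall>r\<in>Q. G (q + r) z = G q z + G r z) \<and> - norm q \<le> G q z}"
  have [measurable]: "G x \<in> borel_measurable var_measure" for x using int_G[of x] by simp
  have N_meas: "N \<in> sets var_measure"
    unfolding N_def by (intro sets.sets_Collect_countable_All' sets.sets_Collect_conj Q(1)) measurable
  have AE_N: "AE z in var_measure. z \<in> N"
  proof -
    have "AE z in var_measure. \<forall>q\<in>Q. (\<forall>r\<in>Q. G (q + r) z = G q z + G r z) \<and> - norm q \<le> G q z"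
      using G_add G_lower by (simp add: AE_ball_countable[OF Q(1)])
    then show ?thesis using AE_space by eventually_elim (simp add: N_def)
  qed
  have "\<exists>\<phi> :: 'e \<Rightarrow>\<^sub>L real. norm \<phi> \<le> 1 \<and> (\<forall>q\<in>Q. blinfun_apply \<phi> q = indicator N z * G q z)" for z
  proof (cases "z \<in> N")
    case True
    have "\<exists>\<phi> :: 'e \<Rightarrow>\<^sub>L real. norm \<phi> \<le> 1 \<and> (\<forall>q\<in>Q. blinfun_apply \<phi> q = G q z)"
      by (rule rational_subspace_extension[OF Q(2), of "\<lambda>q. G q z"]) (use True in \<open>auto simp: N_def\<close>)
    then show ?thesis using True by simp
  qed (auto intro: exI[of _ 0])
  then obtain \<phi> :: "'z \<Rightarrow> 'e \<Rightarrow>\<^sub>L real"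
    where \<phi>: "\<And>z. norm (\<phi> z) \<le> 1" "\<And>z q. q \<in> Q \<Longrightarrow> blinfun_apply (\<phi> z) q = indicator N z * G q z"
    by metis
  show thesis
  proof (rule that)
    show "norm (\<phi> z) \<le> 1" for z by (rule \<phi>(1))
    show meas: "(\<lambda>z. blinfun_apply (\<phi> z) q) \<in> borel_measurable var_measure" if "q \<in> Q" for q
      unfolding \<phi>(2)[OF that] using N_meas by measurable
    fix A q assume A: "A \<in> \<MM>" and q: "q \<in> Q"
    have "(LINT z:A|var_measure. blinfun_apply (\<phi> z) q) = (LINT z:A|var_measure. G q z)"
      unfolding set_lebesgue_integral_def
    proof (rule integral_cong_AE)
      show "(\<lambda>z. indicat_real A z *\<^sub>R blinfun_apply (\<phi> z) q) \<in> borel_measurable var_measure"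
        "(\<lambda>z. indicat_real A z *\<^sub>R G q z) \<in> borel_measurable var_measure"
        using A meas[OF q] by (auto intro!: borel_measurable_times borel_measurable_indicator)
      show "AE z in var_measure. indicat_real A z *\<^sub>R blinfun_apply (\<phi> z) q = indicat_real A z *\<^sub>R G q z"
        using AE_N by eventually_elim (simp add: \<phi>(2)[OF q])
    qed
    then show "blinfun_apply (\<nu> A) q = (LINT z:A|var_measure. blinfun_apply (\<phi> z) q)"
      by (simp add: G[OF A])
  qed
qed

section \<open>Countably valued functions against a density\<close>

lemma S_functionsD:
  assumes "s \<in> S_functions Z \<MM>"
  shows "bounded (s ` Z)" "countable (s ` Z)" "s -` {e} \<inter> Z \<in> \<MM>"
  using assms by (auto simp: S_functions_def)

text \<open>On the level set where \<open>s\<close> equals \<open>e\<close> the integrand is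
  \<open>\<phi> z e\<close>, with integral \<open>\<nu>\<close> of the level set applied to
  \<open>e\<close>. The sum over \<open>e\<close> is unordered, so the level series must converge
  absolutely; it is dominated by \<open>C\<close> times the measures of disjoint sets.\<close>

lemma has_sum_S_function:
  assumes s: "s \<in> S_functions Z \<MM>" and sQ: "s ` Z \<subseteq> Q"
    and \<phi>: "\<And>z. norm (\<phi> z) \<le> 1"
    and meas: "\<And>q. q \<in> Q \<Longrightarrow> (\<lambda>z. blinfun_apply (\<phi> z) q) \<in> borel_measurable var_measure"
    and \<nu>: "\<And>A q. A \<in> \<MM> \<Longrightarrow> q \<in> Q \<Longrightarrow> blinfun_apply (\<nu> A) q = (LINT z:A|var_measure. blinfun_apply (\<phi> z) q)"
  shows "(\<lambda>z. blinfun_apply (\<phi> z) (s z)) \<in> borel_measurable var_measure"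
    and "((\<lambda>e. blinfun_apply (\<nu> (s -` {e} \<inter> Z)) e) has_sum
      (LINT z|var_measure. blinfun_apply (\<phi> z) (s z))) UNIV"
proof -
  let ?I = "s ` Z" and ?\<psi> = "\<lambda>z. blinfun_apply (\<phi> z) (s z)"
  note sD = S_functionsD[OF s]
  have count: "countable ?I" by (rule sD(2))
  have s_count: "s \<in> measurable var_measure (count_space ?I)"
    by (subst measurable_count_space_eq_countable[OF count]) (use sD(3) in auto)
  show \<psi>_meas: "?\<psi> \<in> borel_measurable var_measure"
    by (rule measurable_compose_countable'[OF meas s_count count]) (use sQ in auto)
  obtain C where C: "\<And>z. z \<in> Z \<Longrightarrow> norm (s z) \<le> C" using sD(1) by (auto simp: bounded_iff)
  have \<psi>_bound: "norm (?\<psi> z) \<le> C" if "z \<in> Z" for z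
    using norm_blinfun[of "\<phi> z" "s z"] mult_mono[OF \<phi>[of z] C[OF that]] by simp
  have int_\<psi>: "integrable var_measure ?\<psi>"
    by (rule var.integrable_const_bound[OF AE_I2 \<psi>_meas]) (use \<psi>_bound in simp)
  let ?h = "to_nat_on ?I"
  have inj: "inj_on ?h ?I" using count by (rule inj_on_to_nat_on)
  define B where "B k = {z \<in> Z. ?h (s z) = k}" for k
  have B_h: "B (?h e) = s -` {e} \<inter> Z" if "e \<in> ?I" for e
    using that inj by (auto simp: B_def dest: inj_onD)
  have B_out: "B k = {}" if "k \<notin> ?h ` ?I" for k using that by (auto simp: B_def)
  have B_meas: "B k \<in> \<MM>" for k
    using B_h B_out[of k] sD(3) by (cases "k \<in> ?h ` ?I") auto
  have B_disj: "B i \<inter> B j = {}" if "i \<noteq> j" for i j using that by (auto simp: B_def)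
  have B_UN: "(\<Union>k. B k) = Z" by (auto simp: B_def)
  define g where "g k = (LINT z:B k|var_measure. ?\<psi> z)" for k
  have bound_g: "norm (g k) \<le> C * measure var_measure (B k)" for k
  proof -
    have int: "integrable var_measure (\<lambda>z. indicat_real (B k) z *\<^sub>R ?\<psi> z)"
      using B_meas[of k] int_\<psi> by (intro integrable_mult_indicator) auto
    have "norm (g k) \<le> (LINT z|var_measure. norm (indicat_real (B k) z *\<^sub>R ?\<psi> z))"
      unfolding g_def set_lebesgue_integral_def by (rule integral_norm_bound)
    also have "\<dots> \<le> (LINT z|var_measure. C * indicator (B k) z)"
    proof (rule integral_mono[OF integrable_norm[OF int]])
      show "integrable var_measure (\<lambda>z. C * indicator (B k) z)"
        using B_meas[of k] by (intro integrable_mult_right integrable_real_indicator)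
          (auto simp: var.emeasure_eq_measure)
      show "norm (indicat_real (B k) z *\<^sub>R ?\<psi> z) \<le> C * indicator (B k) z" for z
        using \<psi>_bound[of z] by (cases "z \<in> B k") (auto simp: B_def)
    qed
    finally have "norm (g k) \<le> (LINT z|var_measure. C * indicator (B k) z)" .
    then show ?thesis using B_meas[of k] by simp
  qed
  have "summable (\<lambda>k. measure var_measure (B k))"
    by (rule sums_summable[OF var.finite_measure_UNION])
      (use B_meas B_disj in \<open>auto simp: disjoint_family_on_def\<close>)
  then have "summable (\<lambda>k. C * measure var_measure (B k))" by (rule summable_mult)
  then have sum_g: "summable (\<lambda>k. norm (g k))"
    by (rule summable_comparison_test') (use bound_g in simp)
  have "(\<Sum>k. g k) = (LINT z:(\<Union>k. B k)|var_measure. ?\<psi> z)"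
    unfolding g_def
  proof (rule lebesgue_integral_countable_add[symmetric])
    show "set_integrable var_measure (\<Union>k. B k) ?\<psi>"
      unfolding B_UN set_integrable_def by (intro integrable_mult_indicator int_\<psi>) simp
  qed (use B_meas B_disj in auto)
  also have "\<dots> = (LINT z|var_measure. ?\<psi> z)"
    unfolding B_UN set_lebesgue_integral_def by (intro Bochner_Integration.integral_cong) auto
  finally have "g sums (LINT z|var_measure. ?\<psi> z)"
    using summable_norm_cancel[OF sum_g] by (simp add: sums_iff)
  then have "(g has_sum (LINT z|var_measure. ?\<psi> z)) UNIV"
    by (rule norm_summable_imp_has_sum[OF sum_g])
  then have "(g has_sum (LINT z|var_measure. ?\<psi> z)) (?h ` ?I)"
    by (rule has_sum_cong_neutral[THEN iffD1, rotated -1]) (auto simp: g_def B_out set_lebesgue_integral_def)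
  then have "((g \<circ> ?h) has_sum (LINT z|var_measure. ?\<psi> z)) ?I"
    by (simp only: has_sum_reindex[OF inj])
  then show "((\<lambda>e. blinfun_apply (\<nu> (s -` {e} \<inter> Z)) e) has_sum (LINT z|var_measure. ?\<psi> z)) UNIV"
  proof (rule has_sum_cong_neutral[THEN iffD1, rotated -1])
    fix e assume "e \<in> UNIV - ?I"
    then have "s -` {e} \<inter> Z = {}" by auto
    then show "blinfun_apply (\<nu> (s -` {e} \<inter> Z)) e = 0" by simp
  next
    fix e assume "e \<in> ?I \<inter> UNIV"
    then have e: "e \<in> ?I" "e \<in> Q" using sQ by auto
    have "(g \<circ> ?h) e = (LINT z:s -` {e} \<inter> Z|var_measure. ?\<psi> z)" by (simp add: g_def B_h[OF e(1)])
    also have "\<dots> = (LINT z:s -` {e} \<inter> Z|var_measure. blinfun_apply (\<phi> z) e)"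
      unfolding set_lebesgue_integral_def by (intro Bochner_Integration.integral_cong) (auto simp: indicator_def)
    also have "\<dots> = blinfun_apply (\<nu> (s -` {e} \<inter> Z)) e" by (rule \<nu>[symmetric]) (use sD(3) e in auto)
    finally show "(g \<circ> ?h) e = blinfun_apply (\<nu> (s -` {e} \<inter> Z)) e" .
  qed simp
qed

lemma var_integral_bound:
  assumes "\<And>z. z \<in> Z \<Longrightarrow> \<bar>h z\<bar> \<le> C" "h \<in> borel_measurable var_measure"
  shows "\<bar>LINT z|var_measure. h z\<bar> \<le> C * measure var_measure Z"
proof -
  have int: "integrable var_measure h"
    by (rule var.integrable_const_bound[OF AE_I2 assms(2)]) (use assms(1) in simp)
  have "\<bar>LINT z|var_measure. h z\<bar> \<le> (LINT z|var_measure. \<bar>h z\<bar>)"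
    using integral_norm_bound[of var_measure h] by simp
  also have "\<dots> \<le> (LINT z|var_measure. C)"
    by (intro integral_mono integrable_abs int) (use assms(1) in auto)
  finally show ?thesis by (simp add: mult.commute)
qed

text \<open>With \<open>sum_norm_le_variation\<close> as converse, bounds on finite sums and bounds
  on the variation become interchangeable.\<close>

lemma variation_le:
  assumes "K \<ge> 0"
    "\<And>P. finite P \<Longrightarrow> P \<subseteq> \<MM> \<Longrightarrow> disjoint P \<Longrightarrow> (\<Sum>B\<in>P. norm (\<nu> B)) \<le> K"
  shows "measure var_measure Z \<le> K"
proof -
  have "variation Z \<le> ennreal K"
    unfolding variation_def
    by (rule SUP_least) (use assms in \<open>auto simp: families_def sum_ennreal intro: ennreal_leI\<close>)
  then have "ennreal (measure var_measure Z) \<le> ennreal K"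
    by (simp add: emeasure_var_measure flip: var.emeasure_eq_measure)
  then show ?thesis using assms(1) by simp
qed

lemma sum_norm_le_variation:
  assumes "finite P" "P \<subseteq> \<MM>" "disjoint P"
  shows "(\<Sum>B\<in>P. norm (\<nu> B)) \<le> measure var_measure Z"
proof -
  have "P \<in> families Z" using assms space_closed by (auto simp: families_def)
  then have "(\<Sum>B\<in>P. ennreal (norm (\<nu> B))) \<le> emeasure var_measure Z"
    using variation_upper by (simp add: emeasure_var_measure)
  then show ?thesis by (simp add: sum_ennreal var.emeasure_eq_measure)
qed

end

section \<open>Functions with separable range\<close>

lemma additive_isometry_bounded_linear:
  fixes h :: "'a::real_normed_vector \<Rightarrow> 'b::real_normed_vector"
  assumes "bij h" "\<And>x y. h (x + y) = h x + h y" "\<And>x. norm (h x) = norm x"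
  shows "bounded_linear h" "bounded_linear (inv h)"
proof -
  show "bounded_linear h"
    by (rule additive_bounded_imp_bounded_linear[of _ 1]) (simp_all add: assms)
  have h_inv: "h (inv h y) = y" for y using assms(1) by (simp add: bij_is_surj surj_f_inv_f)
  have "inv h (x + y) = inv h x + inv h y" for x y
    by (rule inv_f_eq[OF bij_is_inj[OF assms(1)]]) (simp add: assms(2) h_inv)
  moreover have "norm (inv h x) = norm x" for x using assms(3)[of "inv h x"] h_inv by simp
  ultimately show "bounded_linear (inv h)"
    by (intro additive_bounded_imp_bounded_linear[of _ 1]) simp_all
qed

text \<open>The image of \<open>1\<close> is idempotent and nonzero, hence \<open>1\<close>; real
  linearity of additive isometries does the rest.\<close>

lemma field_isometry_of_real:
  fixes h :: "'a::real_normed_field \<Rightarrow> 'b::real_normed_field"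
  assumes "bij h" "\<And>x y. h (x + y) = h x + h y" "\<And>x y. h (x * y) = h x * h y"
    "\<And>x. norm (h x) = norm x"
  shows "h (of_real r) = of_real r" "inv h (of_real r) = of_real r"
proof -
  interpret bounded_linear h by (rule additive_isometry_bounded_linear) (fact assms)+
  have "h 1 * h 1 = h 1 * 1" using assms(3)[of 1 1] by simp
  moreover have "h 1 \<noteq> 0" using assms(4)[of 1] by auto
  ultimately have "h 1 = 1" by simp
  then show 1: "h (of_real r) = of_real r" by (simp add: of_real_def scaleR)
  then show "inv h (of_real r) = of_real r" by (intro inv_f_eq[OF bij_is_inj[OF assms(1)]])
qed

context banach_space_over
begin

text \<open>A real functional \<open>\<phi>\<close> is the real part of \<open>\<psi> x = \<phi> x - \<i> \<phi> (\<i> x)\<close>.\<close>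

lemma real_functional_factor:
  fixes \<phi> :: "'e \<Rightarrow>\<^sub>L real"
  shows "\<exists>\<psi>\<in>dual_space scale. \<exists>L. bounded_linear L \<and> (\<forall>x. blinfun_apply \<phi> x = L (blinfun_apply \<psi> x))"
  using real_or_complex[where 'a='k]
proof
  assume "\<exists>h::'k \<Rightarrow> real. bij h \<and> (\<forall>x y. h (x + y) = h x + h y) \<and> (\<forall>x y. h (x * y) = h x * h y)
        \<and> (\<forall>x. norm (h x) = norm x)"
  then obtain h :: "'k \<Rightarrow> real" where h: "bij h" "\<And>x y. h (x + y) = h x + h y"
    "\<And>x y. h (x * y) = h x * h y" "\<And>x. norm (h x) = norm x" by blast
  note lin = additive_isometry_bounded_linear[OF h(1,2,4)]
  have h_inv: "h (inv h y) = y" for y using h(1) by (simp add: bij_is_surj surj_f_inv_f)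
  define \<psi> where "\<psi> = Blinfun (\<lambda>x. inv h (blinfun_apply \<phi> x))"
  have \<psi>: "blinfun_apply \<psi> x = inv h (blinfun_apply \<phi> x)" for x
    unfolding \<psi>_def
    by (simp add: bounded_linear_Blinfun_apply bounded_linear_compose[OF lin(2) blinfun.bounded_linear_right])
  have "\<psi> \<in> dual_space scale"
    unfolding dual_space_def bounded_ops_def
  proof (safe)
    fix c x
    have c: "c = of_real (h c)"
      using field_isometry_of_real(2)[OF h, of "h c"] h(1) by (simp add: bij_is_inj)
    have "h (blinfun_apply \<psi> (scale c x)) = h c * blinfun_apply \<phi> x"
      by (subst c, subst scale_of_real) (simp add: \<psi> h_inv blinfun.scaleR_right linear_scale[OF bounded_linear.linear[OF lin(1)]]
          linear_scale[OF bounded_linear.linear[OF lin(2)]])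
    also have "\<dots> = h (c * blinfun_apply \<psi> x)" by (simp add: h(3) \<psi> h_inv)
    finally show "blinfun_apply \<psi> (scale c x) = c * blinfun_apply \<psi> x"
      using h(1) by (simp add: bij_is_inj inj_eq)
  qed
  then show ?thesis by (intro bexI[of _ \<psi>] exI[of _ h]) (auto simp: lin \<psi> h_inv)
next
  assume "\<exists>h::'k \<Rightarrow> complex. bij h \<and> (\<forall>x y. h (x + y) = h x + h y) \<and> (\<forall>x y. h (x * y) = h x * h y)
        \<and> (\<forall>x. norm (h x) = norm x)"
  then obtain h :: "'k \<Rightarrow> complex" where h: "bij h" "\<And>x y. h (x + y) = h x + h y"
    "\<And>x y. h (x * y) = h x * h y" "\<And>x. norm (h x) = norm x" by blast
  note lin = additive_isometry_bounded_linear[OF h(1,2,4)]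
  have h_inv: "h (inv h y) = y" and inv_h: "inv h (h x) = x" for x y
    using h(1) by (simp_all add: bij_is_surj surj_f_inv_f bij_is_inj)
  define i where "i = inv h \<i>"
  define g where "g x = Complex (blinfun_apply \<phi> x) (- blinfun_apply \<phi> (scale i x))" for x
  have norm_i: "norm i = 1" using h(4)[of i] by (simp add: i_def h_inv)
  have g_add: "g (x + y) = g x + g y" for x y
    by (simp add: g_def scale_right_distrib blinfun.add_right complex_eq_iff)
  have "bounded_linear g"
  proof (rule additive_bounded_imp_bounded_linear[OF g_add])
    fix x
    have "norm (g x) \<le> \<bar>blinfun_apply \<phi> x\<bar> + \<bar>blinfun_apply \<phi> (scale i x)\<bar>"
      using cmod_le[of "g x"] by (simp add: g_def)
    also have "\<dots> \<le> norm \<phi> * norm x + norm \<phi> * norm (scale i x)"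
      using norm_blinfun[of \<phi> x] norm_blinfun[of \<phi> "scale i x"] by simp
    finally show "norm (g x) \<le> (2 * norm \<phi>) * norm x" by (simp add: norm_scale norm_i ac_simps)
  qed
  note g_lin = bounded_linear_compose[OF lin(2) this]
  define \<psi> where "\<psi> = Blinfun (\<lambda>x. inv h (g x))"
  have \<psi>: "blinfun_apply \<psi> x = inv h (g x)" for x
    unfolding \<psi>_def by (simp add: bounded_linear_Blinfun_apply g_lin)
  have "\<psi> \<in> dual_space scale"
    unfolding dual_space_def bounded_ops_def
  proof (safe)
    fix c x
    define a b where "a = Re (h c)" and "b = Im (h c)"
    have hc: "h c = of_real a + of_real b * \<i>" by (simp add: a_def b_def complex_eq_iff)
    have "h (of_real a + of_real b * i) = of_real a + of_real b * \<i>"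
      by (simp only: h(2,3) field_isometry_of_real(1)[OF h] i_def h_inv)
    then have "h (of_real a + of_real b * i) = h c" by (simp only: hc)
    then have c: "c = of_real a + of_real b * i" using bij_is_inj[OF h(1)] by (simp only: inj_eq)
    have ii: "i * i = of_real (- 1)"
    proof -
      have "h (i * i) = h (of_real (- 1))"
        unfolding field_isometry_of_real(1)[OF h] by (simp add: h(3) i_def h_inv)
      then show ?thesis using bij_is_inj[OF h(1)] by (simp only: inj_eq)
    qed
    have sc: "scale c x = a *\<^sub>R x + b *\<^sub>R scale i x"
      unfolding c scale_left_distrib scale_scale[symmetric] scale_of_real ..
    have "scale i (scale c x) = scale (of_real a * i + of_real b * of_real (- 1)) x"
      unfolding scale_scale c ii[symmetric] by (simp only: algebra_simps)
    then have sic: "scale i (scale c x) = a *\<^sub>R scale i x - b *\<^sub>R x"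
      unfolding scale_left_distrib scale_scale[symmetric] scale_of_real by simp
    have "h (blinfun_apply \<psi> (scale c x)) = g (scale c x)" by (simp add: \<psi> h_inv)
    also have "\<dots> = h c * g x"
      unfolding g_def sic unfolding sc hc
      by (simp add: complex_eq_iff blinfun.add_right blinfun.diff_right blinfun.scaleR_right)
    also have "\<dots> = h (c * blinfun_apply \<psi> x)" by (simp add: h(3) \<psi> h_inv)
    finally show "blinfun_apply \<psi> (scale c x) = c * blinfun_apply \<psi> x"
      using h(1) by (simp add: bij_is_inj inj_eq)
  qed
  moreover have "bounded_linear (\<lambda>k. Re (h k))"
    by (rule bounded_linear_compose[OF bounded_linear_Re lin(1)])
  ultimately show ?thesis
    by (intro bexI[of _ \<psi>] exI[of _ "\<lambda>k. Re (h k)"]) (auto simp: \<psi> h_inv g_def)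
qed

text \<open>The weak topology is generated by scalar-linear functionals, while densities and norming
  functionals are only real-linear; the factorization bridges the two.\<close>

lemma weak_limit_real_functional:
  fixes \<phi> :: "'e \<Rightarrow>\<^sub>L real"
  assumes "limitin (weak_topology scale) x l F"
  shows "((\<lambda>n. blinfun_apply \<phi> (x n)) \<longlongrightarrow> blinfun_apply \<phi> l) F"
proof -
  obtain \<psi> L where \<psi>: "\<psi> \<in> dual_space scale" and L: "bounded_linear L"
    "\<And>x. blinfun_apply \<phi> x = L (blinfun_apply \<psi> x)" using real_functional_factor by blast
  show ?thesis unfolding L(2)
    by (rule bounded_linear.tendsto[OF L(1)]) (use assms \<psi> in \<open>auto simp: limitin_weak_topology\<close>)
qed

lemma M_functions_real_functional:
  fixes \<phi> :: "'e \<Rightarrow>\<^sub>L real"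
  assumes "f \<in> M_functions scale Z \<MM>"
  shows "(\<lambda>z. blinfun_apply \<phi> (f z)) \<in> borel_measurable (sigma Z \<MM>)"
proof -
  obtain \<psi> L where \<psi>: "\<psi> \<in> dual_space scale" and L: "bounded_linear L"
    "\<And>x. blinfun_apply \<phi> x = L (blinfun_apply \<psi> x)" using real_functional_factor by blast
  have "L \<in> borel_measurable borel"
    by (intro borel_measurable_continuous_onI linear_continuous_on L)
  moreover have "blinfun_apply \<psi> \<circ> f \<in> borel_measurable (sigma Z \<MM>)"
    using assms \<psi> by (auto simp: M_functions_def)
  ultimately show ?thesis unfolding L(2) by (simp add: measurable_compose comp_def)
qed

end

section \<open>Separability and countably valued approximation\<close>

lemma separable_imp_countable_dense:
  fixes X :: "'a::metric_space set"
  assumes "separable_space (top_of_set X)"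
  obtains D where "countable D" "X \<subseteq> closure D"
  using assms by (auto simp: separable_space_def closure_of_subtopology dest: that)

text \<open>\<open>D\<close> may lie outside \<open>X\<close>, so each of its points is replaced by
  nearby points of \<open>X\<close>, one for every precision at which such a point exists.\<close>

lemma separable_subset_closure:
  fixes X :: "'a::metric_space set"
  assumes D: "countable D" "X \<subseteq> closure D"
  shows "separable_space (top_of_set X)"
proof -
  define pick where "pick d n = (SOME x. x \<in> X \<and> dist x d < 1 / real (Suc n))" for d n
  have pick: "pick d n \<in> X \<and> dist (pick d n) d < 1 / real (Suc n)"
    if "x \<in> X" "dist x d < 1 / real (Suc n)" for x d n
    unfolding pick_def by (rule someI[of _ x]) (use that in simp)
  \<comment> \<open>Where no point of \<open>X\<close> is close enough to \<open>d\<close>, the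
    choice is arbitrary; the intersection discards it if it falls outside \<open>X\<close>.\<close>
  define C where "C = X \<inter> (\<lambda>(d, n). pick d n) ` (D \<times> UNIV)"
  have "x \<in> closure C" if x: "x \<in> X" for x
    unfolding closure_approachable
  proof (intro allI impI)
    fix e :: real assume "e > 0"
    then obtain n where n: "1 / real (Suc n) < e / 2"
      using nat_approx_posE[of "e / 2"] by auto
    obtain d where d: "d \<in> D" "dist d x < 1 / real (Suc n)"
    proof -
      have "x \<in> closure D" using x D(2) by blast
      then show ?thesis using that by (auto simp: closure_approachable dest: spec[of _ "1 / real (Suc n)"])
    qed
    then have p: "pick d n \<in> X" "dist (pick d n) d < 1 / real (Suc n)"
      using pick[OF x, of d n] by (auto simp: dist_commute)
    have "dist (pick d n) x < e" using dist_triangle[of "pick d n" x d] p d n by simp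
    moreover have "pick d n \<in> C" using p d by (auto simp: C_def)
    ultimately show "\<exists>y\<in>C. dist y x < e" by blast
  qed
  moreover have "countable C" using D(1) by (auto simp: C_def intro: countable_subset[OF _ countable_image])
  moreover have "C \<subseteq> X" by (auto simp: C_def)
  ultimately show ?thesis
    unfolding separable_space_def
    by (intro exI[of _ C]) (auto simp: closure_of_subtopology Int_absorb1)
qed

locale banach_measurable_space = banach_space_over scale + sigma_algebra Z \<MM>
  for scale :: "'k::real_or_complex \<Rightarrow> 'e::banach \<Rightarrow> 'e" and Z :: "'z set" and \<MM>
begin

lemma sets_sigma: "sets (sigma Z \<MM>) = \<MM>"
  by (simp add: sets_measure_of[OF space_closed] sigma_sets_eq)

lemma space_sigma: "space (sigma Z \<MM>) = Z"
  by (simp add: space_measure_of[OF space_closed])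

lemma S_function_measurable_count_space:
  assumes s: "s \<in> S_functions Z \<MM>"
  shows "s \<in> measurable (sigma Z \<MM>) (count_space (s ` Z))"
  using s by (subst measurable_count_space_eq_countable) (auto simp: S_functions_def sets_sigma space_sigma)

lemma S_functions_subset_M_functions: "S_functions Z \<MM> \<subseteq> M_functions scale Z \<MM>"
proof
  fix s :: "'z \<Rightarrow> 'e" assume s: "s \<in> S_functions Z \<MM>"
  have "separable_space (top_of_set (s ` Z))"
    using s by (intro separable_subset_closure[of "s ` Z"]) (auto simp: S_functions_def closure_subset)
  moreover have "blinfun_apply \<psi> \<circ> s \<in> borel_measurable (sigma Z \<MM>)" for \<psi> :: "'e \<Rightarrow>\<^sub>L 'k"
    by (rule measurable_comp[OF S_function_measurable_count_space[OF s]]) simp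
  ultimately show "s \<in> M_functions scale Z \<MM>" using s by (auto simp: S_functions_def M_functions_def)
qed

text \<open>The approximant takes at \<open>z\<close> the first member of a numbering of
  \<open>D\<close> within \<open>\<epsilon>\<close> of \<open>f z\<close>. That its values lie in
  \<open>D\<close> matters: with \<open>D\<close> a rational subspace they lie where the density
  represents the measure.\<close>

lemma S_function_approximation:
  fixes f :: "'z \<Rightarrow> 'e"
  assumes f: "f \<in> M_functions scale Z \<MM>" and D: "countable D" "f ` Z \<subseteq> closure D" and \<epsilon>: "\<epsilon> > 0"
  obtains s where "s \<in> S_functions Z \<MM>" "s ` Z \<subseteq> D" "\<And>z. z \<in> Z \<Longrightarrow> norm (f z - s z) \<le> \<epsilon>"
proof (cases "Z = {}")
  case True
  then have "(\<lambda>_. 0) \<in> S_functions Z \<MM>" by (auto simp: S_functions_def)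
  then show thesis using True by (intro that) auto
next
  case False
  then have "D \<noteq> {}" using D(2) by auto
  have approachable: "\<exists>d\<in>D. dist d (f z) < e" if "z \<in> Z" "e > 0" for z e
  proof -
    have "f z \<in> closure D" using D(2) that(1) by blast
    then show ?thesis using that(2) by (simp add: closure_approachable)
  qed
  have "\<exists>\<phi> :: 'e \<Rightarrow>\<^sub>L real. norm \<phi> \<le> 1 \<and> blinfun_apply \<phi> y = norm y" for y
    by (rule norming_functional[of y]) blast
  then obtain \<Phi> :: "'e \<Rightarrow> 'e \<Rightarrow>\<^sub>L real" where \<Phi>: "\<And>y. norm (\<Phi> y) \<le> 1" "\<And>y. blinfun_apply (\<Phi> y) y = norm y"
    by metis
  have \<Phi>_le: "blinfun_apply (\<Phi> y) x \<le> norm x" for x y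
    using norm_blinfun[of "\<Phi> y" x] mult_right_mono[OF \<Phi>(1)[of y], of "norm x"] by simp
  \<comment> \<open>Balls are cut out by countably many functionals, as in Pettis' theorem.\<close>
  have norm_iff: "norm (f z - c) \<le> \<epsilon> \<longleftrightarrow> (\<forall>d\<in>D. blinfun_apply (\<Phi> (d - c)) (f z - c) \<le> \<epsilon>)"
    if z: "z \<in> Z" for z c
  proof (intro iffI ballI)
    fix d assume "norm (f z - c) \<le> \<epsilon>"
    then show "blinfun_apply (\<Phi> (d - c)) (f z - c) \<le> \<epsilon>" using \<Phi>_le order_trans by blast
  next
    assume *: "\<forall>d\<in>D. blinfun_apply (\<Phi> (d - c)) (f z - c) \<le> \<epsilon>"
    \<comment> \<open>For \<open>d\<close> close to \<open>f z\<close>, the functional norming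
      \<open>d - c\<close> almost norms \<open>f z - c\<close>.\<close>
    show "norm (f z - c) \<le> \<epsilon>"
    proof (rule field_le_epsilon)
      fix e :: real assume e: "e > 0"
      then obtain d where d: "d \<in> D" "dist d (f z) < e / 2"
        using approachable[OF z, of "e / 2"] by auto
      have "norm (d - c) = blinfun_apply (\<Phi> (d - c)) (d - f z) + blinfun_apply (\<Phi> (d - c)) (f z - c)"
        by (simp add: \<Phi>(2) flip: blinfun.add_right)
      also have "\<dots> \<le> norm (d - f z) + \<epsilon>" using \<Phi>_le * d(1) by (intro add_mono) auto
      finally have "norm (d - c) \<le> e / 2 + \<epsilon>" using d(2) by (simp add: dist_norm)
      moreover have "norm (f z - c) \<le> norm (f z - d) + norm (d - c)"
        using norm_triangle_ineq[of "f z - d" "d - c"] by simp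
      ultimately show "norm (f z - c) \<le> \<epsilon> + e" using d(2) by (simp add: dist_norm norm_minus_commute)
    qed
  qed
  let ?M = "sigma Z \<MM>"
  have ball_meas: "{z \<in> space ?M. norm (f z - c) \<le> \<epsilon>} \<in> sets ?M" for c
  proof -
    have "(\<lambda>z. blinfun_apply (\<Phi> (d - c)) (f z - c)) \<in> borel_measurable ?M" for d
      unfolding blinfun.diff_right
      by (intro borel_measurable_diff M_functions_real_functional[OF f]) simp
    then have "{z \<in> space ?M. \<forall>d\<in>D. blinfun_apply (\<Phi> (d - c)) (f z - c) \<le> \<epsilon>} \<in> sets ?M"
      by (intro sets.sets_Collect_countable_All' D(1) borel_measurable_le) auto
    also have "{z \<in> space ?M. \<forall>d\<in>D. blinfun_apply (\<Phi> (d - c)) (f z - c) \<le> \<epsilon>} =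
        {z \<in> space ?M. norm (f z - c) \<le> \<epsilon>}" using norm_iff by (auto simp: space_sigma)
    finally show ?thesis .
  qed
  define N where "N z = (LEAST n. norm (f z - from_nat_into D n) \<le> \<epsilon>)" for z
  define s where "s z = from_nat_into D (N z)" for z
  have "N \<in> measurable ?M (count_space UNIV)"
    unfolding N_def[abs_def] by (intro measurable_Least) (use ball_meas in \<open>simp add: pred_def\<close>)
  then have s_meas: "s \<in> measurable ?M (count_space UNIV)"
    unfolding s_def[abs_def] by (rule measurable_compose) simp
  have s_D: "s z \<in> D" for z unfolding s_def by (rule from_nat_into[OF \<open>D \<noteq> {}\<close>])
  have approx: "norm (f z - s z) \<le> \<epsilon>" if z: "z \<in> Z" for z
  proof -
    obtain d where d: "d \<in> D" "dist d (f z) < \<epsilon>"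
      using approachable[OF z \<epsilon>] by blast
    obtain n where "from_nat_into D n = d" using from_nat_into_surj[OF D(1) d(1)] by blast
    then have "norm (f z - from_nat_into D n) \<le> \<epsilon>"
      using d(2) by (simp add: dist_norm norm_minus_commute)
    then show ?thesis unfolding s_def N_def by (rule LeastI)
  qed
  obtain C where C: "\<And>z. z \<in> Z \<Longrightarrow> norm (f z) \<le> C"
    using f by (auto simp: M_functions_def bounded_iff)
  have "norm (s z) \<le> C + \<epsilon>" if "z \<in> Z" for z
    using C[OF that] approx[OF that] norm_triangle_ineq2[of "s z" "f z"] by (simp add: norm_minus_commute)
  then have "bounded (s ` Z)" by (auto simp: bounded_iff)
  moreover have "countable (s ` Z)" by (rule countable_subset[OF _ D(1)]) (use s_D in auto)
  moreover have "s -` {e} \<inter> Z \<in> \<MM>" for e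
    using measurable_sets[OF s_meas, of "{e}"] by (simp add: sets_sigma space_sigma)
  ultimately have "s \<in> S_functions Z \<MM>" by (auto simp: S_functions_def)
  then show thesis by (rule that) (use s_D approx in auto)
qed

end

section \<open>The weak* integral\<close>

locale weak_star_measure =
  E: banach_measurable_space sE Z \<MM> + F: banach_space_over sF
  for sE :: "'k::real_or_complex \<Rightarrow> 'e::banach \<Rightarrow> 'e" and sF :: "'k \<Rightarrow> 'f::banach \<Rightarrow> 'f"
    and Z :: "'z set" and \<MM> +
  fixes \<mu> :: "'z set \<Rightarrow> ('e \<Rightarrow>\<^sub>L ('f \<Rightarrow>\<^sub>L 'k))"
  assumes weak_star_i_measure: "weak_star_i_measure sE sF \<MM> \<mu>"
begin

text \<open>For \<open>b\<close> in \<open>Basis\<close> this is a real coordinate of the value at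
  \<open>v\<close>. Taking it forgets scalar-linearity, so components are treated as measures with
  values in the real dual.\<close>

abbreviation component :: "'f \<Rightarrow> 'k \<Rightarrow> 'z set \<Rightarrow> ('e \<Rightarrow>\<^sub>L real)" where
  "component v b A \<equiv> blinfun_inner_left b o\<^sub>L pairing v (\<mu> A)"

lemma component_apply: "blinfun_apply (component v b A) x = blinfun_apply (blinfun_apply (\<mu> A) x) v \<bullet> b"
  by (simp add: inner_commute)

sublocale comp: real_i_measure Z \<MM> "component v b" for v :: 'f and b :: 'k
proof (unfold_locales)
  have i: "i_measure sE (*) \<MM> (\<lambda>A. pairing v (\<mu> A))"
    using weak_star_i_measure by (auto simp: weak_star_i_measure_def)
  show "i_measure scaleR (*) \<MM> (component v b)"
    unfolding i_measure_def
  proof (intro conjI allI impI)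
    show "component v b ` \<MM> \<subseteq> bounded_ops scaleR (*)"
      by (auto simp: bounded_ops_def blinfun.scaleR_right)
    fix A :: "nat \<Rightarrow> 'z set" assume A: "range A \<subseteq> \<MM>" "disjoint_family A"
    show "(\<lambda>n. blinfun_apply (component v b (A n)) x) sums blinfun_apply (component v b (\<Union>n. A n)) x" for x
    proof -
      have "(\<lambda>n. blinfun_apply (pairing v (\<mu> (A n))) x) sums blinfun_apply (pairing v (\<mu> (\<Union>n. A n))) x"
        using i A unfolding i_measure_def by blast
      from bounded_linear.sums[OF bounded_linear_inner_left this] show ?thesis
        by (simp only: component_apply pairing_apply)
    qed
    show "independently_convergent (\<lambda>n. component v b (A n))"
      unfolding independently_convergent_def
    proof (intro allI impI)
      fix x :: "nat \<Rightarrow> 'e" assume "bounded (range x)"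
      then have "summable (\<lambda>n. blinfun_apply (pairing v (\<mu> (A n))) (x n))"
        using i A unfolding i_measure_def independently_convergent_def by blast
      from bounded_linear.summable[OF bounded_linear_inner_left this]
      show "summable (\<lambda>n. blinfun_apply (component v b (A n)) (x n))"
        by (simp only: component_apply pairing_apply)
    qed
  qed
qed

text \<open>At each fixed \<open>v\<close> the sums in \<open>H\<close> are controlled by finite
  variations. Uniform boundedness makes the control uniform in norm, and half-norming vectors carry
  it back to the variations, at the price of a factor \<open>2\<close>.\<close>

lemma variation_linear_bound:
  obtains K where "K \<ge> 0" "\<And>v b. b \<in> Basis \<Longrightarrow> measure (comp.var_measure b v) Z \<le> K * norm v"
proof -
  \<comment> \<open>The sums whose norms define the total semivariation; the \<open>W\<close> found
    for \<open>H\<close> bounds it.\<close>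
  define H where "H = {\<Sum>B\<in>P. blinfun_apply (\<mu> B) (x B) | P x.
    finite P \<and> P \<subseteq> \<MM> \<and> disjoint P \<and> (\<forall>B. norm (x B) \<le> 1)}"
  have apply_sum: "blinfun_apply (\<Sum>B\<in>P. blinfun_apply (\<mu> B) (x B)) v \<bullet> b =
      (\<Sum>B\<in>P. blinfun_apply (component v b B) (x B))" for P x v b
    by (simp only: blinfun.sum_left inner_sum_left component_apply)
  have "\<exists>C. \<forall>T\<in>H. norm (blinfun_apply T v) \<le> C" for v
  proof (intro exI ballI)
    fix T assume "T \<in> H"
    then obtain P x where P: "finite P" "P \<subseteq> \<MM>" "disjoint P" and x: "\<And>B. norm (x B) \<le> 1"
      and T: "T = (\<Sum>B\<in>P. blinfun_apply (\<mu> B) (x B))" by (auto simp: H_def)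
    have "norm (blinfun_apply T v) \<le> (\<Sum>b\<in>Basis. \<bar>blinfun_apply T v \<bullet> b\<bar>)" by (rule norm_le_l1)
    also have "\<dots> \<le> (\<Sum>b\<in>Basis. measure (comp.var_measure b v) Z)"
    proof (rule sum_mono)
      fix b :: 'k
      have "\<bar>blinfun_apply T v \<bullet> b\<bar> \<le> (\<Sum>B\<in>P. \<bar>blinfun_apply (component v b B) (x B)\<bar>)"
        unfolding T apply_sum by (rule sum_abs)
      also have "\<dots> \<le> (\<Sum>B\<in>P. norm (component v b B))"
      proof (rule sum_mono)
        fix B
        show "\<bar>blinfun_apply (component v b B) (x B)\<bar> \<le> norm (component v b B)"
          using norm_blinfun[of "component v b B" "x B"]
            mult_left_mono[OF x[of B], of "norm (component v b B)"] by simp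
      qed
      also have "\<dots> \<le> measure (comp.var_measure b v) Z" by (rule comp.sum_norm_le_variation[OF P])
      finally show "\<bar>blinfun_apply T v \<bullet> b\<bar> \<le> measure (comp.var_measure b v) Z" .
    qed
    finally show "norm (blinfun_apply T v) \<le> (\<Sum>b\<in>Basis. measure (comp.var_measure b v) Z)" .
  qed
  then obtain W where W: "W \<ge> 0" "\<And>T. T \<in> H \<Longrightarrow> norm T \<le> W" by (rule uniform_boundedness) blast
  show thesis
  proof (rule that)
    show "0 \<le> 2 * W" using W(1) by simp
    fix v and b :: 'k assume b: "b \<in> Basis"
    show "measure (comp.var_measure b v) Z \<le> 2 * W * norm v"
    proof (rule comp.variation_le)
      fix P :: "'z set set" assume P: "finite P" "P \<subseteq> \<MM>" "disjoint P"
      have "\<exists>x. norm x \<le> 1 \<and> norm (component v b B) \<le> 2 * blinfun_apply (component v b B) x" for B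
        by (rule half_norming_vector[of "component v b B"]) blast
      then obtain x where x: "\<And>B. norm (x B) \<le> 1"
        "\<And>B. norm (component v b B) \<le> 2 * blinfun_apply (component v b B) (x B)" by metis
      let ?T = "\<Sum>B\<in>P. blinfun_apply (\<mu> B) (x B)"
      have "?T \<in> H" using P x(1) by (auto simp: H_def)
      then have "norm (blinfun_apply ?T v) \<le> W * norm v"
        by (intro order_trans[OF norm_blinfun] mult_right_mono W(2)) simp_all
      have "(\<Sum>B\<in>P. norm (component v b B)) \<le> (\<Sum>B\<in>P. 2 * blinfun_apply (component v b B) (x B))"
        by (intro sum_mono x(2))
      also have "\<dots> = 2 * (blinfun_apply ?T v \<bullet> b)" by (simp only: apply_sum sum_distrib_left)
      also have "\<dots> \<le> 2 * norm (blinfun_apply ?T v)"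
        using Basis_le_norm[OF b, of "blinfun_apply ?T v"] by simp
      also have "\<dots> \<le> 2 * W * norm v" using \<open>norm (blinfun_apply ?T v) \<le> W * norm v\<close> by simp
      finally show "(\<Sum>B\<in>P. norm (component v b B)) \<le> 2 * W * norm v" .
    qed (use W(1) in simp)
  qed
qed

text \<open>What is gained is that a single \<open>\<phi>\<close>, depending on \<open>v\<close>,
  \<open>b\<close> and \<open>Q\<close>, serves every \<open>Q\<close>-valued function
  \<open>s\<close>, so that different functions can be compared pointwise.\<close>

lemma weak_density_component:
  assumes "countable Q" "rational_subspace Q"
  obtains \<phi> where "\<And>z. norm (\<phi> z) \<le> 1"
    "\<And>s. s \<in> S_functions Z \<MM> \<Longrightarrow> s ` Z \<subseteq> Q \<Longrightarrow>
      (\<lambda>z. blinfun_apply (\<phi> z) (s z)) \<in> borel_measurable (comp.var_measure b v)"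
    "\<And>s. s \<in> S_functions Z \<MM> \<Longrightarrow> s ` Z \<subseteq> Q \<Longrightarrow>
      ((\<lambda>e. blinfun_apply (blinfun_apply (\<mu> (s -` {e} \<inter> Z)) e) v \<bullet> b) has_sum
        (LINT z|comp.var_measure b v. blinfun_apply (\<phi> z) (s z))) UNIV"
proof -
  obtain \<phi> where \<phi>: "\<And>z. norm (\<phi> z) \<le> 1"
    "\<And>q. q \<in> Q \<Longrightarrow> (\<lambda>z. blinfun_apply (\<phi> z) q) \<in> borel_measurable (comp.var_measure b v)"
    "\<And>A q. A \<in> \<MM> \<Longrightarrow> q \<in> Q \<Longrightarrow>
      blinfun_apply (component v b A) q = (LINT z:A|comp.var_measure b v. blinfun_apply (\<phi> z) q)"
    by (rule comp.weak_density[OF assms, where v=v and b=b]) blast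
  show thesis
  proof (rule that)
    fix s assume s: "s \<in> S_functions Z \<MM>" "s ` Z \<subseteq> Q"
    note hs = comp.has_sum_S_function[OF s \<phi>]
    show "(\<lambda>z. blinfun_apply (\<phi> z) (s z)) \<in> borel_measurable (comp.var_measure b v)" by (rule hs(1))
    show "((\<lambda>e. blinfun_apply (blinfun_apply (\<mu> (s -` {e} \<inter> Z)) e) v \<bullet> b) has_sum
        (LINT z|comp.var_measure b v. blinfun_apply (\<phi> z) (s z))) UNIV"
      using hs(2) unfolding component_apply .
  qed (rule \<phi>(1))
qed

section \<open>The integral on countably valued functions\<close>

abbreviation S_integral :: "('z \<Rightarrow> 'e) \<Rightarrow> 'f \<Rightarrow> 'k" where
  "S_integral s v \<equiv> \<Sum>\<^sub>\<infinity>e. blinfun_apply (blinfun_apply (\<mu> (s -` {e} \<inter> Z)) e) v"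

text \<open>An infinite sum that does not converge is \<open>0\<close> by convention, so convergence
  has to be established; it is done coordinate by coordinate with a density on the rational span of
  the values of \<open>s\<close>.\<close>

lemma has_sum_S_integral:
  assumes s: "s \<in> S_functions Z \<MM>"
  shows "((\<lambda>e. blinfun_apply (blinfun_apply (\<mu> (s -` {e} \<inter> Z)) e) v) has_sum S_integral s v) UNIV"
proof -
  let ?g = "\<lambda>e. blinfun_apply (blinfun_apply (\<mu> (s -` {e} \<inter> Z)) e) v"
  have "countable (s ` Z)" using s by (simp add: S_functions_def)
  then obtain Q where Q: "countable Q" "s ` Z \<subseteq> Q" "rational_subspace Q" by (rule countable_rational_span)
  have "\<exists>c. ((\<lambda>e. ?g e \<bullet> b) has_sum c) UNIV" for b
  proof (rule weak_density_component[OF Q(1,3), where v=v and b=b])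
    fix \<phi> :: "'z \<Rightarrow> 'e \<Rightarrow>\<^sub>L real"
    assume "\<And>s. s \<in> S_functions Z \<MM> \<Longrightarrow> s ` Z \<subseteq> Q \<Longrightarrow>
      ((\<lambda>e. blinfun_apply (blinfun_apply (\<mu> (s -` {e} \<inter> Z)) e) v \<bullet> b) has_sum
        (LINT z|comp.var_measure b v. blinfun_apply (\<phi> z) (s z))) UNIV"
    from this[OF s Q(2)] show ?thesis by (rule exI)
  qed
  then have "\<exists>c. \<forall>b. ((\<lambda>e. ?g e \<bullet> b) has_sum c b) UNIV" by (intro choice allI)
  then obtain c where c: "\<And>b. ((\<lambda>e. ?g e \<bullet> b) has_sum c b) UNIV" by blast
  have "((\<lambda>e. \<Sum>b\<in>B. (?g e \<bullet> b) *\<^sub>R b) has_sum (\<Sum>b\<in>B. c b *\<^sub>R b)) UNIV" for B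
  proof (induction B rule: infinite_finite_induct)
    case (insert b B)
    then show ?case
      using has_sum_add[OF has_sum_bounded_linear[OF bounded_linear_scaleR_left[of b] c[of b]]] by simp
  qed (auto intro: has_sum_0)
  from this[of Basis] show ?thesis
    unfolding euclidean_representation by (simp only: infsumI)
qed

lemma has_sum_S_integral_inner:
  assumes s: "s \<in> S_functions Z \<MM>"
  shows "((\<lambda>e. blinfun_apply (blinfun_apply (\<mu> (s -` {e} \<inter> Z)) e) v \<bullet> b) has_sum (S_integral s v \<bullet> b)) UNIV"
  using has_sum_bounded_linear[OF bounded_linear_inner_left[of b] has_sum_S_integral[OF s, of v]]
  by (simp add: o_def)

text \<open>Both integrals are taken against one density on a rational span containing both ranges,
  which replaces a common refinement of level sets. The factor \<open>DIM('k)\<close> comes from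
  bounding the norm of a scalar by the sum of its coordinates.\<close>

lemma S_integral_diff_bound:
  obtains K where "K \<ge> 0"
    "\<And>s t \<delta> v. s \<in> S_functions Z \<MM> \<Longrightarrow> t \<in> S_functions Z \<MM> \<Longrightarrow> \<delta> \<ge> 0 \<Longrightarrow>
      (\<And>z. z \<in> Z \<Longrightarrow> norm (s z - t z) \<le> \<delta>) \<Longrightarrow>
      norm (S_integral s v - S_integral t v) \<le> K * \<delta> * norm v"
proof -
  obtain W where W: "W \<ge> 0" "\<And>v b. b \<in> Basis \<Longrightarrow> measure (comp.var_measure b v) Z \<le> W * norm v"
    by (rule variation_linear_bound) blast
  show thesis
  proof (rule that)
    show "0 \<le> real DIM('k) * W" using W(1) by simp
    fix s t :: "'z \<Rightarrow> 'e" and \<delta> :: real and v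
    assume s: "s \<in> S_functions Z \<MM>" and t: "t \<in> S_functions Z \<MM>" and \<delta>: "\<delta> \<ge> 0"
      and st: "\<And>z. z \<in> Z \<Longrightarrow> norm (s z - t z) \<le> \<delta>"
    have "countable (s ` Z \<union> t ` Z)" using s t by (simp add: S_functions_def)
    then obtain Q where Q: "countable Q" "s ` Z \<union> t ` Z \<subseteq> Q" "rational_subspace Q"
      by (rule countable_rational_span)
    have "\<bar>(S_integral s v - S_integral t v) \<bullet> b\<bar> \<le> W * norm v * \<delta>" if b: "b \<in> Basis" for b
    proof -
      obtain \<phi> where \<phi>: "\<And>z. norm (\<phi> z) \<le> 1"
        and meas: "\<And>s. s \<in> S_functions Z \<MM> \<Longrightarrow> s ` Z \<subseteq> Q \<Longrightarrow>
          (\<lambda>z. blinfun_apply (\<phi> z) (s z)) \<in> borel_measurable (comp.var_measure b v)"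
        and hs: "\<And>s. s \<in> S_functions Z \<MM> \<Longrightarrow> s ` Z \<subseteq> Q \<Longrightarrow>
          ((\<lambda>e. blinfun_apply (blinfun_apply (\<mu> (s -` {e} \<inter> Z)) e) v \<bullet> b) has_sum
            (LINT z|comp.var_measure b v. blinfun_apply (\<phi> z) (s z))) UNIV"
        by (rule weak_density_component[OF Q(1,3), where v=v and b=b]) blast
      have eq: "S_integral r v \<bullet> b = (LINT z|comp.var_measure b v. blinfun_apply (\<phi> z) (r z))"
        if "r \<in> S_functions Z \<MM>" "r ` Z \<subseteq> Q" for r
        by (rule has_sum_unique[OF has_sum_S_integral_inner[OF that(1)] hs[OF that]])
      have int: "integrable (comp.var_measure b v) (\<lambda>z. blinfun_apply (\<phi> z) (r z))"
        if r: "r \<in> S_functions Z \<MM>" "r ` Z \<subseteq> Q" for r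
      proof -
        obtain C where "\<And>z. z \<in> Z \<Longrightarrow> norm (r z) \<le> C" using r by (auto simp: S_functions_def bounded_iff)
        then show ?thesis
          using order_trans[OF abs_blinfun_le_norm[OF \<phi>]]
          by (intro comp.var.integrable_const_bound[OF AE_I2 meas[OF r], of C]) simp
      qed
      have "(S_integral s v - S_integral t v) \<bullet> b =
          (LINT z|comp.var_measure b v. blinfun_apply (\<phi> z) (s z - t z))"
        using eq[of s] eq[of t] int[of s] int[of t] s t Q(2)
        by (simp add: inner_diff_left blinfun.diff_right)
      also have "\<bar>\<dots>\<bar> \<le> \<delta> * measure (comp.var_measure b v) Z"
      proof (rule comp.var_integral_bound)
        show "\<bar>blinfun_apply (\<phi> z) (s z - t z)\<bar> \<le> \<delta>" if "z \<in> Z" for z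
          using abs_blinfun_le_norm[OF \<phi>] st[OF that] by (rule order_trans)
        show "(\<lambda>z. blinfun_apply (\<phi> z) (s z - t z)) \<in> borel_measurable (comp.var_measure b v)"
          unfolding blinfun.diff_right using meas[of s] meas[of t] s t Q(2) by (intro borel_measurable_diff) auto
      qed
      also have "\<dots> \<le> \<delta> * (W * norm v)" by (intro mult_left_mono W(2) b \<delta>)
      finally show ?thesis by (simp add: mult.commute)
    qed
    then have "(\<Sum>b\<in>Basis. \<bar>(S_integral s v - S_integral t v) \<bullet> b\<bar>) \<le> real DIM('k) * (W * norm v * \<delta>)"
      by (intro sum_bounded_above)
    with norm_le_l1[of "S_integral s v - S_integral t v"]
    show "norm (S_integral s v - S_integral t v) \<le> real DIM('k) * W * \<delta> * norm v"
      by (simp add: ac_simps)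
  qed
qed

lemma zero_S_function: "(\<lambda>_. 0 :: 'e) \<in> S_functions Z \<MM>"
proof -
  have "countable ((\<lambda>_. 0::'e) ` Z)" "bounded ((\<lambda>_. 0::'e) ` Z)"
    by (auto intro: countable_subset[of _ "{0}"] simp: bounded_iff)
  moreover have "(\<lambda>_. 0) -` {e} \<inter> Z \<in> \<MM>" for e :: 'e by (cases "e = 0") auto
  ultimately show ?thesis by (simp add: S_functions_def)
qed

text \<open>\<open>Blinfun\<close> returns the given function only if it is bounded and linear;
  boundedness is the difference bound against the zero function.\<close>

lemma weak_star_integral_S_apply:
  assumes s: "s \<in> S_functions Z \<MM>"
  shows "blinfun_apply (weak_star_integral_S Z \<mu> s) v = S_integral s v"
proof -
  obtain K where K: "K \<ge> 0"
    "\<And>s t \<delta> v. s \<in> S_functions Z \<MM> \<Longrightarrow> t \<in> S_functions Z \<MM> \<Longrightarrow> \<delta> \<ge> 0 \<Longrightarrow>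
      (\<And>z. z \<in> Z \<Longrightarrow> norm (s z - t z) \<le> \<delta>) \<Longrightarrow>
      norm (S_integral s v - S_integral t v) \<le> K * \<delta> * norm v"
    by (rule S_integral_diff_bound) blast
  obtain C where C: "C \<ge> 0" "\<And>z. z \<in> Z \<Longrightarrow> norm (s z) \<le> C"
  proof -
    obtain C where "C > 0" "\<forall>x\<in>s ` Z. norm x \<le> C"
      using s unfolding S_functions_def bounded_pos by blast
    then show thesis by (intro that[of C]) auto
  qed
  have zero: "S_integral (\<lambda>_. 0) v = 0" for v
  proof (rule infsum_0)
    fix e :: 'e
    have "blinfun_apply (component v b ((\<lambda>_. 0) -` {e} \<inter> Z)) e = 0" for b
    proof (cases "e = 0")
      case False
      then have "(\<lambda>_. 0) -` {e} \<inter> Z = ({} :: 'z set)" by auto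
      then show ?thesis by (simp only: comp.measure_empty blinfun.zero_left)
    qed (simp add: blinfun.zero_right)
    then show "blinfun_apply (blinfun_apply (\<mu> ((\<lambda>_. 0) -` {e} \<inter> Z)) e) v = 0"
      unfolding component_apply by (simp add: euclidean_eq_iff[where 'a='k])
  qed
  have "bounded_linear (S_integral s)"
  proof (rule additive_bounded_imp_bounded_linear)
    fix u v
    show "S_integral s (u + v) = S_integral s u + S_integral s v"
      using has_sum_add[OF has_sum_S_integral[OF s, of u] has_sum_S_integral[OF s, of v]]
      by (simp add: blinfun.add_right infsumI)
    show "norm (S_integral s v) \<le> K * C * norm v"
      using K(2)[OF s zero_S_function C(1), of v] C(2) unfolding zero by simp
  qed
  then show ?thesis by (simp add: weak_star_integral_S_def bounded_linear_Blinfun_apply)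
qed

abbreviation "integral_S \<equiv> weak_star_integral_S Z \<mu>"

lemma weak_star_integral_S_in_dual:
  assumes s: "s \<in> S_functions Z \<MM>"
  shows "integral_S s \<in> dual_space sF"
proof -
  have dual: "blinfun_apply (blinfun_apply (\<mu> A) e) (sF c v) = c * blinfun_apply (blinfun_apply (\<mu> A) e) v"
    if "A \<in> \<MM>" for A e c v
  proof -
    have "blinfun_apply (\<mu> A) e \<in> dual_space sF"
      using weak_star_i_measure that unfolding weak_star_i_measure_def bounded_ops_to_dual_def by blast
    then show ?thesis by (simp add: dual_space_def bounded_ops_def)
  qed
  have "S_integral s (sF c v) = c * S_integral s v" for c v
  proof (rule infsumI)
    have "s -` {e} \<inter> Z \<in> \<MM>" for e using s by (simp add: S_functions_def)
    then show "((\<lambda>e. blinfun_apply (blinfun_apply (\<mu> (s -` {e} \<inter> Z)) e) (sF c v)) has_sum c * S_integral s v) UNIV"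
      using has_sum_bounded_linear[OF bounded_linear_mult_right[of c] has_sum_S_integral[OF s, of v]]
      by (simp only: dual)
  qed
  then show ?thesis by (simp add: dual_space_def bounded_ops_def weak_star_integral_S_apply[OF s])
qed

section \<open>Extension by density to weakly measurable functions\<close>

definition lipschitz_const :: real where
  "lipschitz_const = (SOME K. K \<ge> 0 \<and> (\<forall>s\<in>S_functions Z \<MM>. \<forall>t\<in>S_functions Z \<MM>. \<forall>\<delta>\<ge>0.
     (\<forall>z\<in>Z. norm (s z - t z) \<le> \<delta>) \<longrightarrow> norm (integral_S s - integral_S t) \<le> K * \<delta>))"

lemma lipschitz_const:
  shows "lipschitz_const \<ge> 0"
    and "\<And>s t \<delta>. s \<in> S_functions Z \<MM> \<Longrightarrow> t \<in> S_functions Z \<MM> \<Longrightarrow> \<delta> \<ge> 0 \<Longrightarrow>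
      (\<And>z. z \<in> Z \<Longrightarrow> norm (s z - t z) \<le> \<delta>) \<Longrightarrow>
      norm (integral_S s - integral_S t) \<le> lipschitz_const * \<delta>"
proof -
  obtain K where K: "K \<ge> 0"
    "\<And>s t \<delta> v. s \<in> S_functions Z \<MM> \<Longrightarrow> t \<in> S_functions Z \<MM> \<Longrightarrow> \<delta> \<ge> 0 \<Longrightarrow>
      (\<And>z. z \<in> Z \<Longrightarrow> norm (s z - t z) \<le> \<delta>) \<Longrightarrow>
      norm (S_integral s v - S_integral t v) \<le> K * \<delta> * norm v"
    by (rule S_integral_diff_bound) blast
  have "K \<ge> 0 \<and> (\<forall>s\<in>S_functions Z \<MM>. \<forall>t\<in>S_functions Z \<MM>. \<forall>\<delta>\<ge>0.
     (\<forall>z\<in>Z. norm (s z - t z) \<le> \<delta>) \<longrightarrow> norm (integral_S s - integral_S t) \<le> K * \<delta>)"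
  proof (intro conjI ballI allI impI K(1))
    fix s t :: "'z \<Rightarrow> 'e" and \<delta> :: real
    assume s: "s \<in> S_functions Z \<MM>" and t: "t \<in> S_functions Z \<MM>" and \<delta>: "0 \<le> \<delta>"
      and st: "\<forall>z\<in>Z. norm (s z - t z) \<le> \<delta>"
    show "norm (integral_S s - integral_S t) \<le> K * \<delta>"
    proof (rule norm_blinfun_bound)
      show "0 \<le> K * \<delta>" using K(1) \<delta> by simp
      show "norm (blinfun_apply (integral_S s - integral_S t) v) \<le> K * \<delta> * norm v" for v
        unfolding blinfun.diff_left weak_star_integral_S_apply[OF s] weak_star_integral_S_apply[OF t]
        by (rule K(2)[OF s t \<delta>]) (use st in blast)
    qed
  qed
  from someI[of "\<lambda>K. K \<ge> 0 \<and> (\<forall>s\<in>S_functions Z \<MM>. \<forall>t\<in>S_functions Z \<MM>. \<forall>\<delta>\<ge>0.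
     (\<forall>z\<in>Z. norm (s z - t z) \<le> \<delta>) \<longrightarrow> norm (integral_S s - integral_S t) \<le> K * \<delta>)", OF this]
  have *: "lipschitz_const \<ge> 0 \<and> (\<forall>s\<in>S_functions Z \<MM>. \<forall>t\<in>S_functions Z \<MM>. \<forall>\<delta>\<ge>0.
     (\<forall>z\<in>Z. norm (s z - t z) \<le> \<delta>) \<longrightarrow> norm (integral_S s - integral_S t) \<le> lipschitz_const * \<delta>)"
    unfolding lipschitz_const_def .
  show "lipschitz_const \<ge> 0" using * by (rule conjunct1)
  fix s t :: "'z \<Rightarrow> 'e" and \<delta> :: real
  assume "s \<in> S_functions Z \<MM>" "t \<in> S_functions Z \<MM>" "\<delta> \<ge> 0" "\<And>z. z \<in> Z \<Longrightarrow> norm (s z - t z) \<le> \<delta>"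
  with * show "norm (integral_S s - integral_S t) \<le> lipschitz_const * \<delta>" by blast
qed

definition approximant :: "('z \<Rightarrow> 'e) \<Rightarrow> nat \<Rightarrow> 'z \<Rightarrow> 'e" where
  "approximant f n = (SOME s. s \<in> S_functions Z \<MM> \<and> (\<forall>z\<in>Z. norm (f z - s z) \<le> 1 / real (Suc n)))"

text \<open>The restriction makes the value \<open>undefined\<close> outside the domain, as the
  extensional function space in the definition of the integral demands.\<close>

definition integral_M :: "('z \<Rightarrow> 'e) \<Rightarrow> 'f \<Rightarrow>\<^sub>L 'k" where
  "integral_M = (\<lambda>f\<in>M_functions sE Z \<MM>. lim (\<lambda>n. integral_S (approximant f n)))"

lemma S_function_approximation_ex:
  assumes f: "f \<in> M_functions sE Z \<MM>" and \<epsilon>: "\<epsilon> > 0"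
  shows "\<exists>s. s \<in> S_functions Z \<MM> \<and> (\<forall>z\<in>Z. norm (f z - s z) \<le> \<epsilon>)"
proof -
  have "separable_space (top_of_set (f ` Z))" using f by (simp add: M_functions_def)
  then obtain D where "countable D" "f ` Z \<subseteq> closure D" by (rule separable_imp_countable_dense)
  from E.S_function_approximation[OF f this \<epsilon>] show ?thesis by metis
qed

lemma approximant:
  assumes f: "f \<in> M_functions sE Z \<MM>"
  shows "approximant f n \<in> S_functions Z \<MM>"
    "z \<in> Z \<Longrightarrow> norm (f z - approximant f n z) \<le> 1 / real (Suc n)"
proof -
  have "approximant f n \<in> S_functions Z \<MM> \<and> (\<forall>z\<in>Z. norm (f z - approximant f n z) \<le> 1 / real (Suc n))"
    unfolding approximant_def by (rule someI_ex[OF S_function_approximation_ex[OF f]]) simp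
  then show "approximant f n \<in> S_functions Z \<MM>"
    "z \<in> Z \<Longrightarrow> norm (f z - approximant f n z) \<le> 1 / real (Suc n)" by blast+
qed

lemma integral_S_approximant_diff:
  assumes f: "f \<in> M_functions sE Z \<MM>" and s: "s \<in> S_functions Z \<MM>" and \<delta>: "\<delta> \<ge> 0"
    and fs: "\<And>z. z \<in> Z \<Longrightarrow> norm (f z - s z) \<le> \<delta>"
  shows "norm (integral_S (approximant f n) - integral_S s) \<le> lipschitz_const * (1 / real (Suc n) + \<delta>)"
proof (rule lipschitz_const(2)[OF approximant(1)[OF f] s])
  fix z assume z: "z \<in> Z"
  have "norm (approximant f n z - s z) \<le> norm (approximant f n z - f z) + norm (f z - s z)"
    using norm_triangle_ineq[of "approximant f n z - f z" "f z - s z"] by simp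
  then show "norm (approximant f n z - s z) \<le> 1 / real (Suc n) + \<delta>"
    using approximant(2)[OF f z, of n] fs[OF z] by (simp add: norm_minus_commute)
qed (use \<delta> in simp)

lemma integral_M_tendsto:
  assumes f: "f \<in> M_functions sE Z \<MM>"
  shows "(\<lambda>n. integral_S (approximant f n)) \<longlonglongrightarrow> integral_M f"
proof -
  have "Cauchy (\<lambda>n. integral_S (approximant f n))"
  proof (rule CauchyI)
    fix e :: real assume e: "e > 0"
    have "(\<lambda>n. lipschitz_const * (1 / real (Suc n) + 1 / real (Suc n))) \<longlonglongrightarrow> lipschitz_const * (0 + 0)"
      by (intro tendsto_intros LIMSEQ_Suc[OF lim_1_over_n])
    then have "\<forall>\<^sub>F n in sequentially. lipschitz_const * (1 / real (Suc n) + 1 / real (Suc n)) < e"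
      using e by (intro order_tendstoD(2)) auto
    then obtain N where N: "lipschitz_const * (1 / real (Suc N) + 1 / real (Suc N)) < e"
      by (auto simp: eventually_sequentially)
    have "norm (integral_S (approximant f m) - integral_S (approximant f n)) < e" if mn: "m \<ge> N" "n \<ge> N" for m n
    proof -
      have "norm (integral_S (approximant f m) - integral_S (approximant f n)) \<le>
          lipschitz_const * (1 / real (Suc m) + 1 / real (Suc n))"
        by (rule integral_S_approximant_diff[OF f approximant(1)[OF f] _ approximant(2)[OF f]]) simp_all
      also have "\<dots> \<le> lipschitz_const * (1 / real (Suc N) + 1 / real (Suc N))"
        by (intro mult_left_mono add_mono lipschitz_const(1) frac_le) (use mn in auto)
      finally show ?thesis using N by simp
    qed
    then show "\<exists>M. \<forall>m\<ge>M. \<forall>n\<ge>M. norm (integral_S (approximant f m) - integral_S (approximant f n)) < e"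
      by blast
  qed
  then show ?thesis using f by (simp add: integral_M_def Cauchy_convergent_iff convergent_LIMSEQ_iff)
qed

lemma integral_M_approx:
  assumes f: "f \<in> M_functions sE Z \<MM>" and s: "s \<in> S_functions Z \<MM>" and \<delta>: "\<delta> \<ge> 0"
    and fs: "\<And>z. z \<in> Z \<Longrightarrow> norm (f z - s z) \<le> \<delta>"
  shows "norm (integral_M f - integral_S s) \<le> lipschitz_const * \<delta>"
proof (rule LIMSEQ_le)
  show "(\<lambda>n. norm (integral_S (approximant f n) - integral_S s)) \<longlonglongrightarrow> norm (integral_M f - integral_S s)"
    by (intro tendsto_intros integral_M_tendsto f)
  have "(\<lambda>n. lipschitz_const * (1 / real (Suc n) + \<delta>)) \<longlonglongrightarrow> lipschitz_const * (0 + \<delta>)"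
    by (intro tendsto_intros LIMSEQ_Suc[OF lim_1_over_n])
  then show "(\<lambda>n. lipschitz_const * (1 / real (Suc n) + \<delta>)) \<longlonglongrightarrow> lipschitz_const * \<delta>" by simp
  show "\<exists>N. \<forall>n\<ge>N. norm (integral_S (approximant f n) - integral_S s) \<le> lipschitz_const * (1 / real (Suc n) + \<delta>)"
    using integral_S_approximant_diff[OF f s \<delta> fs] by blast
qed

lemma integral_M_eq_integral_S: "s \<in> S_functions Z \<MM> \<Longrightarrow> integral_M s = integral_S s"
  using integral_M_approx[of s s 0] E.S_functions_subset_M_functions by auto

lemma integral_M_in_dual:
  assumes f: "f \<in> M_functions sE Z \<MM>"
  shows "integral_M f \<in> dual_space sF"
  unfolding dual_space_def bounded_ops_def
proof safe
  fix c v
  have lim: "(\<lambda>n. blinfun_apply (integral_S (approximant f n)) u) \<longlonglongrightarrow> blinfun_apply (integral_M f) u" for u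
    by (intro tendsto_intros integral_M_tendsto f)
  have "blinfun_apply (integral_S (approximant f n)) (sF c v) =
      c * blinfun_apply (integral_S (approximant f n)) v" for n
    using weak_star_integral_S_in_dual[OF approximant(1)[OF f]] by (simp add: dual_space_def bounded_ops_def)
  then have "(\<lambda>n. c * blinfun_apply (integral_S (approximant f n)) v) \<longlonglongrightarrow> blinfun_apply (integral_M f) (sF c v)"
    using lim[of "sF c v"] by simp
  then show "blinfun_apply (integral_M f) (sF c v) = c * blinfun_apply (integral_M f) v"
    by (rule LIMSEQ_unique[OF _ tendsto_mult_left[OF lim]])
qed

text \<open>One approximant \<open>s\<close> serves both functions, at distance
  \<open>\<delta>\<close> from \<open>f\<close> and \<open>2 * \<delta>\<close> from
  \<open>g\<close>; hence the factor \<open>3\<close>.\<close>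

lemma integral_M_diff:
  assumes f: "f \<in> M_functions sE Z \<MM>" and g: "g \<in> M_functions sE Z \<MM>" and \<delta>: "\<delta> > 0"
    and fg: "\<And>z. z \<in> Z \<Longrightarrow> norm (f z - g z) \<le> \<delta>"
  shows "norm (integral_M f - integral_M g) \<le> 3 * lipschitz_const * \<delta>"
proof -
  obtain s where s: "s \<in> S_functions Z \<MM>" "\<And>z. z \<in> Z \<Longrightarrow> norm (f z - s z) \<le> \<delta>"
    using S_function_approximation_ex[OF f \<delta>] by blast
  have "norm (g z - s z) \<le> 2 * \<delta>" if "z \<in> Z" for z
    using s(2)[OF that] fg[OF that] norm_triangle_ineq[of "g z - f z" "f z - s z"]
    by (simp add: norm_minus_commute)
  then have "norm (integral_M g - integral_S s) \<le> lipschitz_const * (2 * \<delta>)"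
    using g s(1) \<delta> by (intro integral_M_approx) auto
  moreover have "norm (integral_M f - integral_S s) \<le> lipschitz_const * \<delta>"
    using \<delta> by (intro integral_M_approx f s) auto
  moreover have "norm (integral_M f - integral_M g) \<le>
      norm (integral_M f - integral_S s) + norm (integral_M g - integral_S s)"
    using norm_triangle_ineq[of "integral_M f - integral_S s" "integral_S s - integral_M g"]
    by (simp add: norm_minus_commute)
  ultimately show ?thesis by simp
qed

text \<open>The definite description is meaningful only with existence and uniqueness. Two
  continuous extensions agree because countably valued functions are uniformly dense, and outside
  the domain because both are \<open>undefined\<close> there.\<close>

lemma weak_star_integral_eq: "weak_star_integral sE sF Z \<MM> \<mu> = integral_M"
  unfolding weak_star_integral_def
proof (rule the_equality)
  show "integral_M \<in> M_functions sE Z \<MM> \<rightarrow>\<^sub>E dual_space sF \<and>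
     (\<forall>s\<in>S_functions Z \<MM>. integral_M s = integral_S s) \<and>
     (\<forall>f\<in>M_functions sE Z \<MM>. \<forall>\<epsilon>>0. \<exists>\<delta>>0. \<forall>g\<in>M_functions sE Z \<MM>.
        (\<forall>z\<in>Z. norm (f z - g z) \<le> \<delta>) \<longrightarrow> norm (integral_M f - integral_M g) < \<epsilon>)"
  proof (intro conjI ballI allI impI)
    show "integral_M \<in> M_functions sE Z \<MM> \<rightarrow>\<^sub>E dual_space sF"
      by (rule PiE_I, rule integral_M_in_dual) (simp_all add: integral_M_def)
    show "integral_M s = integral_S s" if "s \<in> S_functions Z \<MM>" for s
      using that by (rule integral_M_eq_integral_S)
    fix f and \<epsilon> :: real assume f: "f \<in> M_functions sE Z \<MM>" and \<epsilon>: "\<epsilon> > 0"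
    \<comment> \<open>The added \<open>1\<close> keeps the denominator positive when
      \<open>lipschitz_const\<close> is zero, and the resulting estimate strict.\<close>
    define \<delta> where "\<delta> = \<epsilon> / (3 * lipschitz_const + 1)"
    have "\<delta> > 0" using \<epsilon> lipschitz_const(1) by (simp add: \<delta>_def)
    moreover have "3 * lipschitz_const * \<delta> < \<epsilon>"
      using \<epsilon> lipschitz_const(1) by (simp add: \<delta>_def field_simps)
    ultimately show "\<exists>\<delta>>0. \<forall>g\<in>M_functions sE Z \<MM>.
        (\<forall>z\<in>Z. norm (f z - g z) \<le> \<delta>) \<longrightarrow> norm (integral_M f - integral_M g) < \<epsilon>"
      using integral_M_diff[OF f] by (intro exI[of _ \<delta>]) (auto intro: le_less_trans)
  qed
next
  fix I
  assume "I \<in> M_functions sE Z \<MM> \<rightarrow>\<^sub>E dual_space sF \<and>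
     (\<forall>s\<in>S_functions Z \<MM>. I s = integral_S s) \<and>
     (\<forall>f\<in>M_functions sE Z \<MM>. \<forall>\<epsilon>>0. \<exists>\<delta>>0. \<forall>g\<in>M_functions sE Z \<MM>.
        (\<forall>z\<in>Z. norm (f z - g z) \<le> \<delta>) \<longrightarrow> norm (I f - I g) < \<epsilon>)"
  then have I: "I \<in> M_functions sE Z \<MM> \<rightarrow>\<^sub>E dual_space sF"
      "\<And>s. s \<in> S_functions Z \<MM> \<Longrightarrow> I s = integral_S s"
      "\<And>f \<epsilon>. f \<in> M_functions sE Z \<MM> \<Longrightarrow> \<epsilon> > 0 \<Longrightarrow> \<exists>\<delta>>0. \<forall>g\<in>M_functions sE Z \<MM>.
        (\<forall>z\<in>Z. norm (f z - g z) \<le> \<delta>) \<longrightarrow> norm (I f - I g) < \<epsilon>" by blast+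
  show "I = integral_M"
  proof
    fix f
    show "I f = integral_M f"
    proof (cases "f \<in> M_functions sE Z \<MM>")
      case f: True
      have "norm (I f - integral_M f) \<le> \<epsilon>" if \<epsilon>: "\<epsilon> > 0" for \<epsilon> :: real
      proof -
        obtain \<delta> where \<delta>: "\<delta> > 0" "\<And>g. g \<in> M_functions sE Z \<MM> \<Longrightarrow>
          (\<forall>z\<in>Z. norm (f z - g z) \<le> \<delta>) \<Longrightarrow> norm (I f - I g) < \<epsilon> / 2"
          using I(3)[OF f, of "\<epsilon> / 2"] \<epsilon> by auto
        \<comment> \<open>Small enough for the continuity of \<open>I\<close> at \<open>f\<close>
          and for the Lipschitz estimate of \<open>integral_M\<close>, each costing at most half of
          \<open>\<epsilon>\<close>.\<close>
        define \<eta> where "\<eta> = min \<delta> (\<epsilon> / (2 * (lipschitz_const + 1)))"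
        have \<eta>: "\<eta> > 0" "\<eta> \<le> \<delta>" using \<delta>(1) \<epsilon> lipschitz_const(1) by (auto simp: \<eta>_def)
        obtain s where s: "s \<in> S_functions Z \<MM>" "\<forall>z\<in>Z. norm (f z - s z) \<le> \<eta>"
          using S_function_approximation_ex[OF f \<eta>(1)] by blast
        have "norm (I f - integral_S s) < \<epsilon> / 2"
          using \<delta>(2)[of s] s \<eta>(2) E.S_functions_subset_M_functions by (force simp: I(2))
        moreover have "norm (integral_M f - integral_S s) \<le> lipschitz_const * \<eta>"
          using s \<eta>(1) by (intro integral_M_approx f) auto
        moreover have "lipschitz_const * \<eta> \<le> \<epsilon> / 2"
        proof -
          have "lipschitz_const * \<eta> \<le> lipschitz_const * (\<epsilon> / (2 * (lipschitz_const + 1)))"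
            by (intro mult_left_mono lipschitz_const(1)) (simp add: \<eta>_def)
          also have "\<dots> \<le> \<epsilon> / 2" using \<epsilon> lipschitz_const(1) by (simp add: field_simps)
          finally show ?thesis .
        qed
        ultimately show ?thesis
          using norm_triangle_ineq[of "I f - integral_S s" "integral_S s - integral_M f"]
          by (simp add: norm_minus_commute)
      qed
      then have "norm (I f - integral_M f) \<le> 0" using field_le_epsilon[of "norm (I f - integral_M f)" 0] by simp
      then show ?thesis by simp
    next
      case False
      then show ?thesis using PiE_arb[OF I(1) False] by (simp add: integral_M_def)
    qed
  qed
qed

section \<open>Representation by a density, and the convergence theorem\<close>

lemma integral_M_representation:
  assumes g: "g \<in> M_functions sE Z \<MM>" and Q: "countable Q" "g ` Z \<subseteq> closure Q"
    and \<phi>: "\<And>z. norm (\<phi> z) \<le> 1"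
    and meas: "\<And>s. s \<in> S_functions Z \<MM> \<Longrightarrow> s ` Z \<subseteq> Q \<Longrightarrow>
      (\<lambda>z. blinfun_apply (\<phi> z) (s z)) \<in> borel_measurable (comp.var_measure b v)"
    and hs: "\<And>s. s \<in> S_functions Z \<MM> \<Longrightarrow> s ` Z \<subseteq> Q \<Longrightarrow>
      ((\<lambda>e. blinfun_apply (blinfun_apply (\<mu> (s -` {e} \<inter> Z)) e) v \<bullet> b) has_sum
        (LINT z|comp.var_measure b v. blinfun_apply (\<phi> z) (s z))) UNIV"
  shows "(\<lambda>z. blinfun_apply (\<phi> z) (g z)) \<in> borel_measurable (comp.var_measure b v)"
    and "blinfun_apply (integral_M g) v \<bullet> b = (LINT z|comp.var_measure b v. blinfun_apply (\<phi> z) (g z))"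
proof -
  let ?V = "comp.var_measure b v"
  \<comment> \<open>Values of \<open>g\<close> lie only in \<open>closure Q\<close>, where nothing
    is assumed about \<open>\<phi>\<close>; uniformly close \<open>Q\<close>-valued approximants
    carry both measurability and the integral formula over to \<open>g\<close>.\<close>
  have "\<exists>s. s \<in> S_functions Z \<MM> \<and> s ` Z \<subseteq> Q \<and> (\<forall>z\<in>Z. norm (g z - s z) \<le> 1 / real (Suc n))" for n
    by (rule E.S_function_approximation[OF g Q, of "1 / real (Suc n)"]) auto
  then have "\<exists>s. \<forall>n. s n \<in> S_functions Z \<MM> \<and> s n ` Z \<subseteq> Q \<and> (\<forall>z\<in>Z. norm (g z - s n z) \<le> 1 / real (Suc n))"
    by (intro choice allI)
  then obtain s where "\<forall>n. s n \<in> S_functions Z \<MM> \<and> s n ` Z \<subseteq> Q \<and>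
    (\<forall>z\<in>Z. norm (g z - s n z) \<le> 1 / real (Suc n))" by (rule exE)
  then have s: "\<And>n. s n \<in> S_functions Z \<MM>" "\<And>n. s n ` Z \<subseteq> Q"
    and gs: "\<And>n z. z \<in> Z \<Longrightarrow> norm (g z - s n z) \<le> 1 / real (Suc n)" by simp_all
  have inv0: "(\<lambda>n. 1 / real (Suc n)) \<longlonglongrightarrow> 0" by (rule LIMSEQ_Suc[OF lim_1_over_n])
  have pointwise: "(\<lambda>n. blinfun_apply (\<phi> z) (s n z)) \<longlonglongrightarrow> blinfun_apply (\<phi> z) (g z)" if z: "z \<in> Z" for z
  proof -
    have "(\<lambda>n. s n z) \<longlonglongrightarrow> g z"
      by (rule Lim_transform_bound[OF _ inv0, THEN LIM_zero_cancel])
        (use gs[OF z] in \<open>auto simp: norm_minus_commute\<close>)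
    then show ?thesis by (rule blinfun.tendsto[OF tendsto_const])
  qed
  show meas_g: "(\<lambda>z. blinfun_apply (\<phi> z) (g z)) \<in> borel_measurable ?V"
    by (rule borel_measurable_LIMSEQ_metric[OF meas[OF s]]) (use pointwise in simp)
  obtain C where C: "\<And>z. z \<in> Z \<Longrightarrow> norm (g z) \<le> C"
    using g by (auto simp: M_functions_def bounded_iff)
  have "(\<lambda>n. LINT z|?V. blinfun_apply (\<phi> z) (s n z)) \<longlonglongrightarrow> (LINT z|?V. blinfun_apply (\<phi> z) (g z))"
  \<comment> \<open>The extra \<open>1\<close> covers the approximation error, which is at most
    \<open>1 / (n + 1)\<close>.\<close>
  proof (rule integral_dominated_convergence[where w="\<lambda>_. C + 1"])
    show "AE z in ?V. (\<lambda>n. blinfun_apply (\<phi> z) (s n z)) \<longlonglongrightarrow> blinfun_apply (\<phi> z) (g z)"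
      using pointwise by (intro AE_I2) simp
    show "AE z in ?V. norm (blinfun_apply (\<phi> z) (s n z)) \<le> C + 1" for n
    proof (rule AE_I2)
      fix z assume "z \<in> space ?V"
      then have z: "z \<in> Z" by simp
      have "norm (s n z) \<le> norm (g z) + norm (g z - s n z)"
        using norm_triangle_ineq4[of "g z" "g z - s n z"] by simp
      also have "\<dots> \<le> C + 1"
        using C[OF z] gs[OF z, of n] order_trans[of _ "1 / real (Suc n)" 1] by (intro add_mono) auto
      finally show "norm (blinfun_apply (\<phi> z) (s n z)) \<le> C + 1"
        using abs_blinfun_le_norm[OF \<phi>[of z], of "s n z"] by simp
    qed
  qed (use meas[OF s] meas_g in auto)
  moreover have "(LINT z|?V. blinfun_apply (\<phi> z) (s n z)) = blinfun_apply (integral_S (s n)) v \<bullet> b" for n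
    unfolding weak_star_integral_S_apply[OF s(1)]
    by (rule has_sum_unique[OF hs[OF s] has_sum_S_integral_inner[OF s(1)]])
  moreover have "(\<lambda>n. blinfun_apply (integral_S (s n)) v \<bullet> b) \<longlonglongrightarrow> blinfun_apply (integral_M g) v \<bullet> b"
  proof -
    have "(\<lambda>n. integral_S (s n)) \<longlonglongrightarrow> integral_M g"
    proof (rule Lim_transform_bound[THEN LIM_zero_cancel])
      have "(\<lambda>n. lipschitz_const * (1 / real (Suc n))) \<longlonglongrightarrow> lipschitz_const * 0"
        by (intro tendsto_intros inv0)
      then show "(\<lambda>n. lipschitz_const * (1 / real (Suc n))) \<longlonglongrightarrow> 0" by simp
      show "\<forall>\<^sub>F n in sequentially. norm (integral_S (s n) - integral_M g) \<le> norm (lipschitz_const * (1 / real (Suc n)))"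
      proof (intro always_eventually allI)
        fix n
        have "norm (integral_M g - integral_S (s n)) \<le> lipschitz_const * (1 / real (Suc n))"
          by (rule integral_M_approx[OF g s(1) _ gs]) simp_all
        then show "norm (integral_S (s n) - integral_M g) \<le> norm (lipschitz_const * (1 / real (Suc n)))"
          using lipschitz_const(1) by (simp add: norm_minus_commute)
      qed
    qed
    then show ?thesis by (intro tendsto_intros)
  qed
  ultimately show "blinfun_apply (integral_M g) v \<bullet> b = (LINT z|?V. blinfun_apply (\<phi> z) (g z))"
    using LIMSEQ_unique by simp
qed

text \<open>Membership of the limit is derived, not assumed: its range stays in the separable set
  \<open>closure Q\<close>, norming functionals preserve the bound, and measurability passes to
  pointwise limits. The densities are chosen independently of \<open>n\<close>, so weak convergence
  at each \<open>z\<close> is convergence of the integrands.\<close>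

theorem bounded_weak_star_convergence:
  assumes fn: "\<And>n. fn n \<in> M_functions sE Z \<MM>" and C: "\<And>n z. z \<in> Z \<Longrightarrow> norm (fn n z) \<le> C"
    and weak: "\<And>z. z \<in> Z \<Longrightarrow> limitin (weak_topology sE) (\<lambda>n. fn n z) (f z) sequentially"
  shows "f \<in> M_functions sE Z \<MM>"
    "limitin (weak_star_topology sF) (\<lambda>n. integral_M (fn n)) (integral_M f) sequentially"
proof -
  have weak_real: "(\<lambda>n. blinfun_apply \<phi> (fn n z)) \<longlonglongrightarrow> blinfun_apply \<phi> (f z)"
    if "z \<in> Z" for z and \<phi> :: "'e \<Rightarrow>\<^sub>L real"
    by (rule E.weak_limit_real_functional[OF weak[OF that]])
  have "\<exists>D. countable D \<and> fn n ` Z \<subseteq> closure D" for n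
  proof -
    have "separable_space (top_of_set (fn n ` Z))" using fn[of n] by (simp add: M_functions_def)
    then show ?thesis by (rule separable_imp_countable_dense) blast
  qed
  then have "\<exists>D. \<forall>n. countable (D n) \<and> fn n ` Z \<subseteq> closure (D n)" by (intro choice allI)
  then obtain D where "\<forall>n. countable (D n) \<and> fn n ` Z \<subseteq> closure (D n)" by (rule exE)
  then have D: "\<And>n. countable (D n)" "\<And>n. fn n ` Z \<subseteq> closure (D n)" by simp_all
  then have "countable (\<Union>n. D n)" by auto
  \<comment> \<open>One \<open>Q\<close> for the whole sequence, so that a single density represents
    all integrals.\<close>
  then obtain Q where Q: "countable Q" "(\<Union>n. D n) \<subseteq> Q" "rational_subspace Q"
    by (rule countable_rational_span)
  have fnQ: "fn n ` Z \<subseteq> closure Q" for n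
    using D(2)[of n] closure_mono[of "D n" Q] Q(2) by blast
  have fQ: "f ` Z \<subseteq> closure Q"
  proof safe
    fix z assume z: "z \<in> Z"
    show "f z \<in> closure Q"
      by (rule weak_limit_in_closure[OF Q(3) _ weak_real[OF z]]) (use fnQ z in blast)
  qed
  \<comment> \<open>Weak lower semicontinuity of the norm.\<close>
  have fC: "norm (f z) \<le> C" if z: "z \<in> Z" for z
  proof -
    obtain \<phi> :: "'e \<Rightarrow>\<^sub>L real" where \<phi>: "norm \<phi> \<le> 1" "blinfun_apply \<phi> (f z) = norm (f z)"
      by (rule norming_functional)
    have "blinfun_apply \<phi> (fn n z) \<le> C" for n
      using abs_blinfun_le_norm[OF \<phi>(1), of "fn n z"] C[OF z, of n] by simp
    then have "blinfun_apply \<phi> (f z) \<le> C"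
      by (intro LIMSEQ_le_const2[OF weak_real[OF z]]) auto
    then show ?thesis by (simp add: \<phi>(2))
  qed
  show fM: "f \<in> M_functions sE Z \<MM>"
    unfolding M_functions_def
  proof (intro CollectI conjI ballI)
    show "bounded (f ` Z)" using fC by (auto simp: bounded_iff)
    show "separable_space (top_of_set (f ` Z))" by (rule separable_subset_closure[OF Q(1) fQ])
    fix \<psi> assume \<psi>: "\<psi> \<in> dual_space sE"
    show "blinfun_apply \<psi> \<circ> f \<in> borel_measurable (sigma Z \<MM>)"
    proof (rule borel_measurable_LIMSEQ_metric)
      show "blinfun_apply \<psi> \<circ> fn n \<in> borel_measurable (sigma Z \<MM>)" for n
        using fn[of n] \<psi> by (simp add: M_functions_def)
      show "(\<lambda>n. (blinfun_apply \<psi> \<circ> fn n) z) \<longlonglongrightarrow> (blinfun_apply \<psi> \<circ> f) z"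
        if "z \<in> space (sigma Z \<MM>)" for z
        using weak[of z] that \<psi> by (simp add: E.space_sigma limitin_weak_topology)
    qed
  qed
  show "limitin (weak_star_topology sF) (\<lambda>n. integral_M (fn n)) (integral_M f) sequentially"
  proof (subst limitin_weak_star_topology[OF integral_M_in_dual[OF fn]], intro conjI allI)
    show "integral_M f \<in> dual_space sF" by (rule integral_M_in_dual[OF fM])
    fix v
    show "(\<lambda>n. blinfun_apply (integral_M (fn n)) v) \<longlonglongrightarrow> blinfun_apply (integral_M f) v"
      \<comment> \<open>Scalar convergence is checked coordinatewise, since each density represents
        one real coordinate.\<close>
      unfolding tendsto_componentwise_iff[where l="blinfun_apply (integral_M f) v"]
    proof
      fix b :: 'k
      let ?V = "comp.var_measure b v"
      obtain \<phi> where \<phi>: "\<And>z. norm (\<phi> z) \<le> 1"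
        and meas: "\<And>s. s \<in> S_functions Z \<MM> \<Longrightarrow> s ` Z \<subseteq> Q \<Longrightarrow>
          (\<lambda>z. blinfun_apply (\<phi> z) (s z)) \<in> borel_measurable ?V"
        and hs: "\<And>s. s \<in> S_functions Z \<MM> \<Longrightarrow> s ` Z \<subseteq> Q \<Longrightarrow>
          ((\<lambda>e. blinfun_apply (blinfun_apply (\<mu> (s -` {e} \<inter> Z)) e) v \<bullet> b) has_sum
            (LINT z|?V. blinfun_apply (\<phi> z) (s z))) UNIV"
        by (rule weak_density_component[OF Q(1,3), where v=v and b=b]) blast
      have rep: "(\<lambda>z. blinfun_apply (\<phi> z) (g z)) \<in> borel_measurable ?V"
        "blinfun_apply (integral_M g) v \<bullet> b = (LINT z|?V. blinfun_apply (\<phi> z) (g z))"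
        if "g \<in> M_functions sE Z \<MM>" "g ` Z \<subseteq> closure Q" for g
        by (rule integral_M_representation[OF that(1) Q(1) that(2) \<phi>]; (rule meas hs; assumption))+
      show "(\<lambda>n. blinfun_apply (integral_M (fn n)) v \<bullet> b) \<longlonglongrightarrow> blinfun_apply (integral_M f) v \<bullet> b"
        unfolding rep(2)[OF fn fnQ] rep(2)[OF fM fQ]
      proof (rule integral_dominated_convergence[where w="\<lambda>_. C"])
        show "(\<lambda>z. blinfun_apply (\<phi> z) (f z)) \<in> borel_measurable ?V" by (rule rep(1)[OF fM fQ])
        show "(\<lambda>z. blinfun_apply (\<phi> z) (fn n z)) \<in> borel_measurable ?V" for n by (rule rep(1)[OF fn fnQ])
        show "AE z in ?V. (\<lambda>n. blinfun_apply (\<phi> z) (fn n z)) \<longlonglongrightarrow> blinfun_apply (\<phi> z) (f z)"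
          by (intro AE_I2 weak_real) simp
        show "AE z in ?V. norm (blinfun_apply (\<phi> z) (fn n z)) \<le> C" for n
        proof (rule AE_I2)
          fix z assume "z \<in> space ?V"
          then show "norm (blinfun_apply (\<phi> z) (fn n z)) \<le> C"
            using abs_blinfun_le_norm[OF \<phi>[of z], of "fn n z"] C[of z n] by simp
        qed
      qed simp
    qed
  qed
qed

end

theorem theorem5p5:
  fixes sE :: "'k::real_or_complex \<Rightarrow> 'e::banach \<Rightarrow> 'e"
    and sF :: "'k \<Rightarrow> 'f::banach \<Rightarrow> 'f"
    and Z :: "'z set" and \<MM> :: "'z set set"
    and \<mu> :: "'z set \<Rightarrow> ('e \<Rightarrow>\<^sub>L ('f \<Rightarrow>\<^sub>L 'k))"
    and f :: "'z \<Rightarrow> 'e" and fn :: "nat \<Rightarrow> 'z \<Rightarrow> 'e"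
  assumes "banach_space_over sE"
    and "banach_space_over sF"
    and "sigma_algebra Z \<MM>"
    and "weak_star_i_measure sE sF \<MM> \<mu>"
    and "\<And>n. fn n \<in> M_functions sE Z \<MM>"
    and "\<exists>C. \<forall>n. \<forall>z\<in>Z. norm (fn n z) \<le> C"
    and "\<And>z. z \<in> Z \<Longrightarrow> limitin (weak_topology sE) (\<lambda>n. fn n z) (f z) sequentially"
  shows "f \<in> M_functions sE Z \<MM> \<and>
    limitin (weak_star_topology sF)
      (\<lambda>n. weak_star_integral sE sF Z \<MM> \<mu> (fn n)) (weak_star_integral sE sF Z \<MM> \<mu> f) sequentially"
proof -
  interpret E: banach_space_over sE by fact
  interpret F: banach_space_over sF by fact
  interpret sigma_algebra Z \<MM> by fact
  interpret weak_star_measure sE sF Z \<MM> \<mu> by unfold_locales fact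
  obtain C where "\<And>n z. z \<in> Z \<Longrightarrow> norm (fn n z) \<le> C" using assms(6) by blast
  from bounded_weak_star_convergence[OF assms(5) this assms(7)] show ?thesis
    by (simp only: weak_star_integral_eq)
qed

end
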